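(* Let $4/5<p\leq\infty$. Then the operators $\sigma_n^{\triangle}$ ($n\geq 1$) are uniformly bounded from the dyadic martingale Hardy space $H_p(G\times G)$ to $L_p(G\times G)$: there is a constant $c_p$, depending only on $p$, such that for every $f\in H_p(G\times G)$ $$\sup_{n\geq 1}\left\Vert \sigma_n^{\triangle}f\right\Vert_p\leq c_p\left\Vert f\right\Vert_{H_p}.$$
   Context: $\mathbb{N}=\{0,1,2,\dots\}$. $G=\prod_{k=0}^{\infty}\mathbb{Z}_2$ is the Walsh group (coordinatewise addition mod 2, product topology) with normalized Haar measure $\mu$; elements are $x=(x_0,x_1,\dots)$, $x_k\in\{0,1\}$. $\mu$ also denotes the product measure on $G\times G$. Dyadic intervals: $I_0(x)=G$, $I_n(x)=\{y\in G: y_0=x_0,\dots,y_{n-1}=x_{n-1}\}$. For $n=\sum_{k\ge 0}n_k2^k\in\mathbb{N}$ with $n_k\in\{0,1\}$, the Walsh--Paley function is $w_n(x)=\prod_{k}(-1)^{n_kx_k}$. $F_k$ is the $\sigma$-algebra on $G\times G$ generated by the dyadic cubes $I_k(x)\times I_k(y)$, $x,y\in G$. A martingale $f=(f^{(n)})_{n\in\mathbb{N}}$ is a (one-parameter) martingale with respect to $(F_n)_{n\in\mathbb{N}}$; its maximal function is $f^*=\sup_n|f^{(n)}|$. The Hardy space $H_p(G\times G)$ consists of all such martingales with $\Vert f\Vert_{H_p}:=\Vert f^*\Vert_p<\infty$, where $\Vert g\Vert_p=\left(\int_{G\times G}|g|^pd\mu\right)^{1/p}$ for $0<p<\infty$ and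 $\Vert\cdot\Vert_\infty$ is the essential supremum norm. A function $f\in L_1(G\times G)$ is identified with the martingale of its conditional expectations with respect to $F_n$. Walsh--Fourier coefficients of a martingale: $\widehat f(i,j)=\lim_{k\to\infty}\int_{G\times G}f^{(k)}(x,y)w_i(x)w_j(y)\,d\mu(x,y)$ (for $f\in L_1$ this is $\int f\,w_i(x)w_j(y)\,d\mu$). Triangular partial sums: $S_k^{\triangle}f(x,y)=\sum_{i=0}^{k-1}\sum_{j=0}^{k-i-1}\widehat f(i,j)w_i(x)w_j(y)$ (with $S_0^\triangle f=0$). Triangular Fejér means: $\sigma_n^{\triangle}f=\frac1n\sum_{j=0}^{n-1}S_j^{\triangle}f$, $n\geq1$. *)

theory Defs
  imports "HOL-Probability.Probability" "HOL-Library.Z2"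
begin

section \<open>The Walsh group and its Haar measure\<close>

type_synonym walsh_group = "nat \<Rightarrow> bit"

definition walsh_haar :: "walsh_group measure" where
  "walsh_haar = (\<Pi>\<^sub>M k\<in>UNIV. uniform_count_measure (UNIV :: bit set))"

abbreviation walsh_haar2 :: "(walsh_group \<times> walsh_group) measure" where
  "walsh_haar2 \<equiv> walsh_haar \<Otimes>\<^sub>M walsh_haar"

lemma UNIV_bit: "(UNIV :: bit set) = {0, 1}"
  by (auto intro: bit.exhaust)

lemma space_walsh_haar: "space walsh_haar = UNIV"
  by (simp add: walsh_haar_def space_PiM space_uniform_count_measure)

lemma prob_space_coordinate: "prob_space (uniform_count_measure (UNIV :: bit set))"
  by (rule prob_space_uniform_count_measure) (simp_all add: UNIV_bit)

text \<open>The next two lemmas identify \<^const>\<open>walsh_haar\<close> as the normalized Haar measure.\<close>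

lemma prob_space_walsh_haar: "prob_space walsh_haar"
  unfolding walsh_haar_def by (intro prob_space_PiM prob_space_coordinate)

lemma walsh_haar_translation_invariant:
  fixes a :: walsh_group
  shows "distr walsh_haar walsh_haar (\<lambda>x k. a k + x k) = walsh_haar"
proof -
  let ?U = "uniform_count_measure (UNIV :: bit set)"
  let ?P = "\<Pi>\<^sub>M k\<in>(UNIV :: nat set). ?U"
  interpret product_prob_space "\<lambda>_::nat. ?U" UNIV
    by (intro product_prob_spaceI prob_space_coordinate)
  have m: "(\<lambda>x k. a k + x k) \<in> ?P \<rightarrow>\<^sub>M ?P"
  proof (rule measurable_PiM_single')
    fix i :: nat
    have "(\<lambda>b. a i + b) \<in> ?U \<rightarrow>\<^sub>M ?U"
      by (simp add: measurable_def space_uniform_count_measure sets_uniform_count_measure)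
    then show "(\<lambda>x. a i + x i) \<in> ?P \<rightarrow>\<^sub>M ?U"
      by (rule measurable_compose[OF measurable_component_singleton[OF UNIV_I]])
  qed (simp add: space_PiM space_uniform_count_measure)
  have "distr ?P ?P (\<lambda>x k. a k + x k) = ?P"
  proof (rule PiM_eq)
    fix J :: "nat set" and F :: "nat \<Rightarrow> bit set"
    assume J: "finite J"
    have bb: "b + (b + c) = c" for b c :: bit
      by (cases b; cases c) simp_all
    have fin: "finite (UNIV :: bit set)"
      by (simp add: UNIV_bit)
    have inj: "inj_on ((+) b) A" for b :: bit and A
      by (rule inj_on_inverseI[where g = "(+) b"]) (rule bb)
    have shift: "c \<in> (+) b ` A \<longleftrightarrow> b + c \<in> A" for b c :: bit and A
      by (metis bb image_iff)
    have "(\<lambda>x k. a k + x k) -` prod_emb UNIV (\<lambda>_. ?U) J (Pi\<^sub>E J F) \<inter> space ?P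
        = prod_emb UNIV (\<lambda>_. ?U) J (\<Pi>\<^sub>E j\<in>J. (+) (a j) ` F j)"
      by (rule set_eqI) (simp only: prod_emb_def space_PiM space_uniform_count_measure PiE_UNIV_domain
          vimage_eq Int_iff PiE_iff restrict_apply Pi_UNIV UNIV_I shift, auto simp: PiE_iff)
    then have "emeasure (distr ?P ?P (\<lambda>x k. a k + x k)) (prod_emb UNIV (\<lambda>_. ?U) J (Pi\<^sub>E J F))
        = emeasure ?P (prod_emb UNIV (\<lambda>_. ?U) J (\<Pi>\<^sub>E j\<in>J. (+) (a j) ` F j))"
      using J by (subst emeasure_distr[OF m])
        (auto intro!: sets_PiM_I simp: sets_uniform_count_measure)
    also have "\<dots> = (\<Prod>j\<in>J. emeasure ?U ((+) (a j) ` F j))"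
      using J by (intro emeasure_PiM_emb) (auto simp: sets_uniform_count_measure)
    also have "\<dots> = (\<Prod>j\<in>J. emeasure ?U (F j))"
      by (intro prod.cong refl)
        (simp only: emeasure_uniform_count_measure[OF fin subset_UNIV] card_image[OF inj])
    finally show "emeasure (distr ?P ?P (\<lambda>x k. a k + x k)) (prod_emb UNIV (\<lambda>_. ?U) J (Pi\<^sub>E J F))
        = (\<Prod>j\<in>J. emeasure ?U (F j))" .
  qed simp
  then show ?thesis by (simp add: walsh_haar_def)
qed


section \<open>Walsh--Paley functions\<close>

text \<open>\<^term>\<open>bit n k\<close> is the binary digit \<open>n\<^sub>k\<close>; factors with \<open>n\<^sub>k = 0\<close> are 1 and are left out,
  so the product is finite.\<close>

definition walsh :: "nat \<Rightarrow> walsh_group \<Rightarrow> real" where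
  "walsh n x = (\<Prod>k | bit n k. (- 1) ^ of_bool (x k = 1))"

lemma finite_binary_digits: "finite {k. bit (n::nat) k}"
proof (rule finite_subset)
  show "{k. bit n k} \<subseteq> {..<n}"
  proof clarify
    fix k assume "bit n k"
    then have "2 ^ k \<le> n"
      by (metis bit_iff_odd div_less even_zero not_le)
    then show "k < n"
      using less_exp[of k] by linarith
  qed
qed simp


section \<open>Dyadic filtration and martingales\<close>

definition dyadic_interval :: "nat \<Rightarrow> walsh_group \<Rightarrow> walsh_group set" where
  "dyadic_interval n x = {y. \<forall>k<n. y k = x k}"

definition dyadic_filtration :: "nat \<Rightarrow> (walsh_group \<times> walsh_group) measure" where
  "dyadic_filtration k =
     sigma UNIV {dyadic_interval k x \<times> dyadic_interval k y | x y. True}"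

lemma subalgebra_dyadic_filtration: "subalgebra walsh_haar2 (dyadic_filtration k)"
proof -
  have "dyadic_interval k x \<in> sets walsh_haar" for x
  proof -
    have [measurable]: "(\<lambda>y. y i) \<in> walsh_haar \<rightarrow>\<^sub>M count_space UNIV" for i
      unfolding walsh_haar_def
      using measurable_component_singleton[of i UNIV "\<lambda>_. uniform_count_measure (UNIV :: bit set)"]
      by (simp add: measurable_cong_sets[OF refl sets_uniform_count_measure_count_space])
    have "{y \<in> space walsh_haar. \<forall>i<k. y i = x i} \<in> sets walsh_haar"
      by measurable
    then show ?thesis
      by (simp add: dyadic_interval_def space_walsh_haar)
  qed
  then have "{dyadic_interval k x \<times> dyadic_interval k y | x y. True} \<subseteq> sets walsh_haar2"
    by auto
  then show ?thesis
    using sets.sigma_sets_subset[of _ walsh_haar2]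
    by (simp add: subalgebra_def dyadic_filtration_def space_pair_measure space_walsh_haar)
qed

text \<open>Martingales are complex-valued, which includes the real-valued ones; the conditional
  expectation is taken separately for real and imaginary part.\<close>

definition complex_cond_exp :: "'a measure \<Rightarrow> 'a measure \<Rightarrow> ('a \<Rightarrow> complex) \<Rightarrow> 'a \<Rightarrow> complex" where
  "complex_cond_exp M F f z =
     Complex (real_cond_exp M F (\<lambda>u. Re (f u)) z) (real_cond_exp M F (\<lambda>u. Im (f u)) z)"

definition dyadic_martingale :: "(nat \<Rightarrow> walsh_group \<times> walsh_group \<Rightarrow> complex) \<Rightarrow> bool" where
  "dyadic_martingale f \<longleftrightarrow>
     (\<forall>n. f n \<in> borel_measurable (dyadic_filtration n)) \<and>
     (\<forall>n. integrable walsh_haar2 (f n)) \<and>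
     (\<forall>m n. m \<le> n \<longrightarrow>
        (AE z in walsh_haar2. complex_cond_exp walsh_haar2 (dyadic_filtration m) (f n) z = f m z))"


section \<open>Norms and Hardy spaces\<close>

text \<open>The power \<open>a\<^sup>r\<close> for \<open>r > 0\<close>.\<close>

definition ennreal_power :: "ennreal \<Rightarrow> real \<Rightarrow> ennreal" where
  "ennreal_power a r = (if a = \<top> then \<top> else ennreal (enn2real a powr r))"

text \<open>The (quasi-)norm of a nonnegative function; the exponent ranges over \<open>0 < p \<le> \<infinity>\<close>.\<close>

definition Lp_norm :: "ennreal \<Rightarrow> (walsh_group \<times> walsh_group \<Rightarrow> ennreal) \<Rightarrow> ennreal" where
  "Lp_norm p g =
     (if p = \<top> then esssup walsh_haar2 g
      else ennreal_power (\<integral>\<^sup>+z. ennreal_power (g z) (enn2real p) \<partial>walsh_haar2) (1 / enn2real p))"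

definition maximal_function ::
  "(nat \<Rightarrow> walsh_group \<times> walsh_group \<Rightarrow> complex) \<Rightarrow> walsh_group \<times> walsh_group \<Rightarrow> ennreal" where
  "maximal_function f z = (SUP n. ennreal (cmod (f n z)))"

definition hardy_norm :: "ennreal \<Rightarrow> (nat \<Rightarrow> walsh_group \<times> walsh_group \<Rightarrow> complex) \<Rightarrow> ennreal" where
  "hardy_norm p f = Lp_norm p (maximal_function f)"

definition hardy_space :: "ennreal \<Rightarrow> (nat \<Rightarrow> walsh_group \<times> walsh_group \<Rightarrow> complex) set" where
  "hardy_space p = {f. dyadic_martingale f \<and> hardy_norm p f < \<top>}"


section \<open>Triangular partial sums and Fejer means\<close>

text \<open>For a dyadic martingale the sequence of integrals is eventually constant, so the limit exists.\<close>

definition walsh_coeff ::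
  "(nat \<Rightarrow> walsh_group \<times> walsh_group \<Rightarrow> complex) \<Rightarrow> nat \<Rightarrow> nat \<Rightarrow> complex" where
  "walsh_coeff f i j =
     lim (\<lambda>k. LINT z|walsh_haar2. f k z * of_real (walsh i (fst z)) * of_real (walsh j (snd z)))"

definition triangular_sum ::
  "nat \<Rightarrow> (nat \<Rightarrow> walsh_group \<times> walsh_group \<Rightarrow> complex) \<Rightarrow> walsh_group \<times> walsh_group \<Rightarrow> complex" where
  "triangular_sum k f z =
     (\<Sum>i<k. \<Sum>j<k - i. walsh_coeff f i j * of_real (walsh i (fst z)) * of_real (walsh j (snd z)))"

definition triangular_fejer ::
  "nat \<Rightarrow> (nat \<Rightarrow> walsh_group \<times> walsh_group \<Rightarrow> complex) \<Rightarrow> walsh_group \<times> walsh_group \<Rightarrow> complex" where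
  "triangular_fejer n f z = (\<Sum>j<n. triangular_sum j f z) / of_nat n"

end

theory Submission
  imports Defs
begin

text \<open>
  No atomic decomposition is needed. Choose \<open>N\<close> with \<open>n < 2\<^sup>N \<le> 2n\<close>. Then \<open>\<sigma>\<^sub>n f\<close> is the convolution
  of \<open>f\<^sup>(\<^sup>N\<^sup>)\<close> with a kernel that is constant on dyadic squares of side \<open>2\<^sup>-\<^sup>N\<close>, so both live on a finite
  group of order \<open>4\<^sup>N\<close>, and \<open>|f\<^sup>(\<^sup>N\<^sup>)| \<le> f\<^sup>*\<close>. By the \<open>p\<close>-triangle inequality (\<open>p \<le> 1\<close>) or
  Jensen's inequality (\<open>p \<ge> 1\<close>) it suffices that the \<open>\<ell>\<^sub>p\<close> quasi-norm (\<open>p \<le> 1\<close>), or the \<open>\<ell>\<^sub>1\<close> norm,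
  of the kernel on this finite group is bounded uniformly in \<open>n\<close>.

  The kernel is \<open>K = \<Sum>\<^bsub>a<n\<^esub> D\<^sub>a(x) D\<^bsub>n-a\<^esub>(y)\<close> up to normalization. If \<open>s\<close> and \<open>t\<close> with \<open>t \<le> s\<close> are the
  positions of the first 1 in \<open>x\<close> and \<open>y\<close>, then \<open>|D\<^sub>a(x)| \<le> 2\<^bsup>s+1\<^esup>\<close>, and for fixed \<open>x\<close> the
  orthogonality in \<open>y\<close> of \<open>D\<^sub>b\<close> and \<open>D\<^bsub>b'\<^esub>\<close> for \<open>b, b'\<close> in different blocks of length \<open>2\<^bsup>t+1\<^esup>\<close> bounds
  the mean square of \<open>K\<close> by \<open>2\<^bsup>2s+3t+5\<^esup> n\<close>. Comparing \<open>p\<close>-th powers with squares and summing over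
  \<open>s\<close> and \<open>t\<close> gives geometric series with ratios \<open>2\<^bsup>2-5p/2\<^esup>\<close> and \<open>2\<^bsup>1-3p/2\<^esup>\<close>;
  the first one converges exactly for \<open>p > 4/5\<close>.
\<close>

section \<open>Walsh functions and Dirichlet kernels\<close>

definition wadd :: "walsh_group \<Rightarrow> walsh_group \<Rightarrow> walsh_group" where
  "wadd x y = (\<lambda>k. x k + y k)"

lemma wadd_commute: "wadd x y = wadd y x"
  unfolding wadd_def by (subst add.commute) (rule refl)

lemma wadd_cancel [simp]: "wadd x (wadd x y) = y"
proof
  fix k show "wadd x (wadd x y) k = y k"
    by (cases "x k"; cases "y k") (simp_all add: wadd_def)
qed

lemma walsh_wadd: "walsh n (wadd x y) = walsh n x * walsh n y"
proof -
  have "(- 1 :: real) ^ of_bool (a + b = 1) = (- 1) ^ of_bool (a = 1) * (- 1) ^ of_bool (b = 1)" for a b :: bit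
    by (cases a; cases b) simp_all
  then show ?thesis
    by (simp add: walsh_def wadd_def prod.distrib)
qed

lemma abs_walsh [simp]: "\<bar>walsh n x\<bar> = 1"
  by (simp add: walsh_def abs_prod power_abs)

text \<open>Translation by the \<open>k\<close>-th unit vector: an involution that changes the sign
  of \<open>walsh n\<close> exactly when digit \<open>k\<close> of \<open>n\<close> is 1.
  Orthogonality comes from it by a change of variables.\<close>

definition wflip :: "nat \<Rightarrow> walsh_group \<Rightarrow> walsh_group" where
  "wflip k x = x(k := x k + 1)"

lemma walsh_wflip: "walsh n (wflip k x) = (if bit n k then - walsh n x else walsh n x)"
proof (cases "bit n k")
  case True
  have "(- 1 :: real) ^ of_bool (a + 1 = 1) = - ((- 1) ^ of_bool (a = 1))" for a :: bit
    by (cases a) simp_all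
  moreover have "(\<Prod>j\<in>{j. bit n j} - {k}. (- 1 :: real) ^ of_bool (wflip k x j = 1))
      = (\<Prod>j\<in>{j. bit n j} - {k}. (- 1) ^ of_bool (x j = 1))"
    by (intro prod.cong) (auto simp: wflip_def)
  ultimately show ?thesis
    using True unfolding walsh_def
    by (simp add: prod.remove[OF finite_binary_digits, of k] wflip_def del: add_bit_eq_xor)
next
  case False
  then have "walsh n (wflip k x) = walsh n x"
    unfolding walsh_def by (intro prod.cong) (auto simp: wflip_def)
  with False show ?thesis by simp
qed

lemma bit_less_power: 
  assumes "bit (n::nat) k" shows "2 ^ k \<le> n"
  using assms by (metis bit_iff_odd div_less even_zero not_le)

lemma walsh_cong:
  assumes "n < 2 ^ N" "\<And>k. k < N \<Longrightarrow> x k = y k"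
  shows "walsh n x = walsh n y"
proof -
  have "k < N" if "bit n k" for k
  proof -
    have "(2::nat) ^ k < 2 ^ N"
      using bit_less_power[OF that] assms(1) by linarith
    then show ?thesis by simp
  qed
  then show ?thesis
    unfolding walsh_def by (intro prod.cong) (auto simp: assms(2))
qed

text \<open>The binary digits of \<open>2 ^ m * q\<close> and \<open>i\<close> are disjoint, so the
  addition has no carries and the product over the digits splits.\<close>

lemma walsh_add:
  assumes "i < 2 ^ m"
  shows "walsh (2 ^ m * q + i) x = walsh (2 ^ m * q) x * walsh i x"
proof -
  have disj: "\<not> (bit (2 ^ m * q) k \<and> bit i k)" for k
  proof -
    have "bit i k \<Longrightarrow> k < m"
      using bit_less_power[of i k] assms 
      by (metis le_less_trans power_strict_increasing_iff rel_simps(49) semiring_norm(76) one_less_numeral_iff)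
    moreover have "bit (2 ^ m * q) k \<Longrightarrow> m \<le> k"
      by (simp add: push_bit_eq_mult[symmetric] bit_simps mult.commute)
    ultimately show ?thesis by fastforce
  qed
  then have "2 ^ m * q + i = Bit_Operations.or (2 ^ m * q) i"
    by (intro disjunctive_add) blast
  then have "{k. bit (2 ^ m * q + i) k} = {k. bit (2 ^ m * q) k} \<union> {k. bit i k}"
    by (auto simp: bit_simps)
  then show ?thesis
    unfolding walsh_def using disj by (simp add: prod.union_disjoint[OF finite_binary_digits finite_binary_digits] disjoint_iff)
qed

lemma walsh_power2: "walsh (2 ^ m) x = (if x m = 1 then - 1 else 1)"
  by (simp add: walsh_def bit_simps)

definition walsh_dirichlet :: "nat \<Rightarrow> walsh_group \<Rightarrow> real" where
  "walsh_dirichlet n x = (\<Sum>i<n. walsh i x)"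

lemma walsh_dirichlet_add:
  assumes "l \<le> 2 ^ m"
  shows "walsh_dirichlet (2 ^ m * q + l) x =
    walsh_dirichlet (2 ^ m * q) x + walsh (2 ^ m * q) x * walsh_dirichlet l x"
proof -
  have "(\<Sum>i<k + l. g i) = (\<Sum>i<k. g i) + (\<Sum>i<l. g (k + i))" for k and g :: "nat \<Rightarrow> real"
    by (induction l) (simp_all add: add.assoc)
  moreover have "(\<Sum>i<l. walsh (2 ^ m * q + i) x) = (\<Sum>i<l. walsh (2 ^ m * q) x * walsh i x)"
    using assms by (intro sum.cong refl walsh_add) simp
  ultimately show ?thesis
    by (simp add: walsh_dirichlet_def sum_distrib_left)
qed

text \<open>When \<open>x s = 1\<close>, the terms with index in [2^s, 2^(s+1)) are the negatives of
  those with index below 2^s. So the first block of length 2^(s+1) sums to 0, and every later block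
  is a multiple of it.\<close>

lemma walsh_dirichlet_multiple_eq_0:
  fixes x :: walsh_group
  assumes "x s = 1"
  shows "walsh_dirichlet (2 ^ Suc s * q) x = 0"
proof -
  have z: "walsh_dirichlet (2 ^ Suc s) x = 0"
    using walsh_dirichlet_add[of "2 ^ s" s 1 x] assms 
    by (simp add: walsh_power2 mult_2)
  show ?thesis
  proof (induction q)
    case 0 then show ?case by (simp add: walsh_dirichlet_def)
  next
    case (Suc q)
    then show ?case
      using walsh_dirichlet_add[of "2 ^ Suc s" "Suc s" q x] z 
      by (simp add: algebra_simps)
  qed
qed

text \<open>Full blocks of length 2^(s+1) cancel, and the incomplete last block factors. The
  alternative \<open>n < 2 ^ Suc s\<close>, where there is no full block, covers the zero
  sequence.\<close>

lemma walsh_dirichlet_reduce: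
  fixes x :: walsh_group
  assumes "x s = 1 \<or> n < 2 ^ Suc s"
  shows "walsh_dirichlet n x = walsh (2 ^ Suc s * (n div 2 ^ Suc s)) x * walsh_dirichlet (n mod 2 ^ Suc s) x"
proof (cases "n < 2 ^ Suc s")
  case True
  then show ?thesis by (simp add: walsh_def)
next
  case False
  with assms have "x s = 1" by simp
  from walsh_dirichlet_multiple_eq_0[of x s, OF this, of "n div 2 ^ Suc s"]
  show ?thesis
    using walsh_dirichlet_add[of "n mod 2 ^ Suc s" "Suc s" "n div 2 ^ Suc s" x]
    by (simp del: power_Suc)
qed

lemma abs_walsh_dirichlet_le: "\<bar>walsh_dirichlet n x\<bar> \<le> real n"
  unfolding walsh_dirichlet_def by (rule order_trans[OF sum_abs]) simp

text \<open>Up to sign only the incomplete last block remains, and it has fewer than 2^(s+1) terms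
  of modulus 1.\<close>

lemma abs_walsh_dirichlet_le_power:
  fixes x :: walsh_group
  assumes "x s = 1 \<or> n < 2 ^ Suc s"
  shows "\<bar>walsh_dirichlet n x\<bar> \<le> 2 ^ Suc s"
proof -
  have "\<bar>walsh_dirichlet n x\<bar> = \<bar>walsh_dirichlet (n mod 2 ^ Suc s) x\<bar>"
    by (subst walsh_dirichlet_reduce[of x s, OF assms]) (simp add: abs_mult)
  also have "\<dots> \<le> real (n mod 2 ^ Suc s)"
    by (rule abs_walsh_dirichlet_le)
  also have "\<dots> \<le> real (2 ^ Suc s)"
    by (intro of_nat_mono less_imp_le) simp
  finally show ?thesis by simp
qed

lemma walsh_dirichlet_wflip:
  assumes "n \<le> 2 ^ k"
  shows "walsh_dirichlet n (wflip k x) = walsh_dirichlet n x"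
  unfolding walsh_dirichlet_def
proof (rule sum.cong[OF refl])
  fix i assume "i \<in> {..<n}"
  then have "\<not> bit i k"
    using bit_less_power[of i k] assms by fastforce
  then show "walsh i (wflip k x) = walsh i x"
    by (simp add: walsh_wflip)
qed

section \<open>The triangular kernel: product form and symmetry\<close>

definition triangular_kernel :: "nat \<Rightarrow> walsh_group \<Rightarrow> walsh_group \<Rightarrow> real" where
  "triangular_kernel n x y = (\<Sum>a<n. walsh_dirichlet a x * walsh_dirichlet (n - a) y)"

lemma sum_triangle_swap:
  "(\<Sum>i<n. \<Sum>j<n - i. g i j) = (\<Sum>j<n. \<Sum>i<n - j. (g i j :: real))" for n :: nat
proof -
  have "(\<Sum>i<n. \<Sum>j<n - i. g i j) = (\<Sum>(i, j)\<in>(SIGMA i:{..<n}. {..<n - i}). g i j)"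
    by (simp add: sum.Sigma)
  also have "\<dots> = (\<Sum>(j, i)\<in>(SIGMA j:{..<n}. {..<n - j}). g i j)"
    by (rule sum.reindex_bij_witness[of _ "\<lambda>(a, b). (b, a)" "\<lambda>(a, b). (b, a)"]) auto
  also have "\<dots> = (\<Sum>j<n. \<Sum>i<n - j. g i j)"
    by (simp add: sum.Sigma)
  finally show ?thesis .
qed

text \<open>The right side is \<open>n\<close> times the Fejer kernel as the definition of the means
  produces it; the product form on the left is the one that can be estimated. In the induction each
  second factor gains one term, and these terms add up to the Dirichlet kernel of the triangle of
  order \<open>n\<close>.\<close>

lemma triangular_kernel_eq:
  "triangular_kernel n x y = (\<Sum>j<n. \<Sum>i<j. \<Sum>l<j - i. walsh i x * walsh l y)"
proof (induction n)
  case 0 then show ?case by (simp add: triangular_kernel_def)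
next
  case (Suc n)
  have "triangular_kernel (Suc n) x y
      = walsh_dirichlet n x * walsh 0 y + (\<Sum>a<n. walsh_dirichlet a x * walsh_dirichlet (Suc n - a) y)"
    by (simp add: triangular_kernel_def) (simp add: walsh_dirichlet_def)
  also have "(\<Sum>a<n. walsh_dirichlet a x * walsh_dirichlet (Suc n - a) y)
      = (\<Sum>a<n. walsh_dirichlet a x * walsh_dirichlet (n - a) y + walsh_dirichlet a x * walsh (n - a) y)"
    by (intro sum.cong refl) (simp add: Suc_diff_le walsh_dirichlet_def algebra_simps)
  also have "\<dots> = triangular_kernel n x y + (\<Sum>a<n. walsh_dirichlet a x * walsh (n - a) y)"
    by (simp add: triangular_kernel_def sum.distrib)
  also have "walsh_dirichlet n x * walsh 0 y + (triangular_kernel n x y + (\<Sum>a<n. walsh_dirichlet a x * walsh (n - a) y))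
      = triangular_kernel n x y + (\<Sum>a<Suc n. walsh_dirichlet a x * walsh (n - a) y)"
    by simp
  also have "(\<Sum>a<Suc n. walsh_dirichlet a x * walsh (n - a) y) = (\<Sum>l<Suc n. walsh_dirichlet (n - l) x * walsh l y)"
    by (subst sum.nat_diff_reindex[symmetric]) (auto intro!: sum.cong)
  \<comment> \<open>The term \<open>l = n\<close> drops out because
    \<open>walsh_dirichlet 0 x\<close> is 0.\<close>
  also have "\<dots> = (\<Sum>l<n. \<Sum>i<n - l. walsh i x * walsh l y)"
    by (simp add: walsh_dirichlet_def sum_distrib_right)
  also have "\<dots> = (\<Sum>i<n. \<Sum>l<n - i. walsh i x * walsh l y)"
    by (rule sum_triangle_swap[symmetric])
  finally show ?case
    by (simp add: Suc.IH add.assoc)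
qed

text \<open>Each triangle i + l < j is symmetric in i and l. This allows the later estimates to
  assume t \<le> s.\<close>

lemma triangular_kernel_commute: "triangular_kernel n x y = triangular_kernel n y x"
  by (simp add: triangular_kernel_eq mult.commute sum_triangle_swap[of "\<lambda>i l. walsh i x * walsh l y"])

section \<open>Finite groups of representatives of the dyadic intervals, and their levels\<close>

definition walsh_points :: "nat set \<Rightarrow> walsh_group set" where
  "walsh_points J = {x. \<forall>k. k \<notin> J \<longrightarrow> x k = 0}"

lemma wflip_wflip [simp]: "wflip k (wflip k x) = x"
proof
  fix j show "wflip k (wflip k x) j = x j"
    by (cases "x j") (auto simp: wflip_def)
qed

text \<open>A new coordinate \<open>j\<close> doubles the set: \<open>wflip j\<close> maps the
  points vanishing at \<open>j\<close> onto those with a 1 there.\<close>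

lemma finite_card_walsh_points:
  assumes "finite J"
  shows "finite (walsh_points J) \<and> card (walsh_points J) = 2 ^ card J"
  using assms
proof (induction J rule: finite_induct)
  case empty
  have "walsh_points {} = {\<lambda>_. 0}" by (auto simp: walsh_points_def)
  then show ?case by simp
next
  case (insert j J)
  have inj: "inj_on (wflip j) A" for A
    by (rule inj_on_inverseI[where g = "wflip j"]) simp
  have "x \<in> wflip j ` walsh_points J" if x: "x \<in> walsh_points (insert j J)" "x \<notin> walsh_points J" for x
  proof (rule image_eqI[of _ _ "wflip j x"])
    from x obtain k where k: "k \<notin> J" "x k \<noteq> 0" by (auto simp: walsh_points_def)
    with x(1) have "x j = 1" by (cases "k = j") (auto simp: walsh_points_def)
    then show "wflip j x \<in> walsh_points J"
      using x(1) by (auto simp: walsh_points_def wflip_def)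
  qed simp
  moreover have "walsh_points J \<subseteq> walsh_points (insert j J)"
    "wflip j ` walsh_points J \<subseteq> walsh_points (insert j J)"
    by (auto simp: walsh_points_def wflip_def)
  ultimately have eq: "walsh_points (insert j J) = walsh_points J \<union> wflip j ` walsh_points J"
    by blast
  have disj: "walsh_points J \<inter> wflip j ` walsh_points J = {}"
    using insert.hyps by (auto simp: walsh_points_def wflip_def)
  show ?case
    unfolding eq using insert disj
    by (simp add: card_Un_disjoint card_image[OF inj])
qed

lemmas finite_walsh_points [simp] = finite_card_walsh_points[THEN conjunct1]
lemmas card_walsh_points = finite_card_walsh_points[THEN conjunct2]

text \<open>Points whose first 1 is at position \<open>s\<close>; the level \<open>s = N\<close> consists of the zero sequence alone.\<close>

definition walsh_level :: "nat \<Rightarrow> nat \<Rightarrow> walsh_group set" where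
  "walsh_level N s = {x \<in> walsh_points {..<N}. (\<forall>i<s. x i = 0) \<and> (s < N \<longrightarrow> x s = 1)}"

lemma finite_walsh_level [simp]: "finite (walsh_level N s)"
  by (rule finite_subset[of _ "walsh_points {..<N}"]) (auto simp: walsh_level_def)

text \<open>Forgetting that coordinate \<open>s\<close> is 1 costs a factor 2 for
  \<open>s < N\<close>, but gives one formula that also covers \<open>s = N\<close>.\<close>

lemma card_walsh_level_le: "card (walsh_level N s) \<le> 2 ^ (N - s)"
proof -
  have "walsh_level N s \<subseteq> walsh_points {s..<N}"
    by (auto simp: walsh_level_def walsh_points_def not_le not_less)
  from card_mono[OF _ this] show ?thesis
    by (simp add: card_walsh_points)
qed

lemma walsh_points_eq_levels: "walsh_points {..<N} = (\<Union>s\<le>N. walsh_level N s)"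
proof (intro equalityI subsetI)
  fix x assume x: "x \<in> walsh_points {..<N}"
  show "x \<in> (\<Union>s\<le>N. walsh_level N s)"
  proof (cases "\<exists>i<N. x i = 1")
    case False
    with x have "x \<in> walsh_level N N" by (auto simp: walsh_level_def)
    then show ?thesis by auto
  next
    case True
    define s where "s = (LEAST i. x i = 1)"
    have s: "x s = 1" using True unfolding s_def by (metis (mono_tags, lifting) LeastI)
    have "x i = 0" if "i < s" for i 
      using not_less_Least[of i "\<lambda>i. x i = 1"] that by (simp add: s_def)
    moreover have "s < N" using s x by (force simp: walsh_points_def)
    ultimately show ?thesis using s x by (auto simp: walsh_level_def intro!: bexI[of _ s])
  qed
qed (auto simp: walsh_level_def)

lemma walsh_level_disjoint:
  assumes "s \<noteq> t" "s \<le> N" "t \<le> N"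
  shows "walsh_level N s \<inter> walsh_level N t = {}"
proof -
  have "walsh_level N s \<inter> walsh_level N t = {}" if "s < t" "t \<le> N" for s t
    using that by (fastforce simp: walsh_level_def)
  from this[of s t] this[of t s] assms show ?thesis by (cases "s < t") auto
qed

lemma sum_walsh_points_levels:
  fixes h :: "walsh_group \<Rightarrow> real"
  shows "(\<Sum>x\<in>walsh_points {..<N}. h x) = (\<Sum>s\<le>N. \<Sum>x\<in>walsh_level N s. h x)"
  unfolding walsh_points_eq_levels
  by (rule sum.UNION_disjoint) (auto dest: walsh_level_disjoint)

text \<open>Supplies the hypothesis of \<open>walsh_dirichlet_reduce\<close>: at the level
  \<open>s = N\<close> the point is zero, and the size of \<open>n\<close> takes over.\<close>

lemma walsh_levelD:
  assumes "x \<in> walsh_level N s" "s \<le> N" "n < 2 ^ N"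
  shows "x s = 1 \<or> (n::nat) < 2 ^ Suc s"
  using assms by (cases "s = N") (auto simp: walsh_level_def)

section \<open>The triangular kernel on dyadic levels\<close>

text \<open>In the reduced form of the kernel the remainder is below 2^(s+1) \<le> 2^j, so its
  Dirichlet kernel does not see coordinate \<open>j\<close>. Only the Walsh factor does, and its
  index has the same digit \<open>j\<close> as \<open>n\<close>.\<close>

lemma walsh_dirichlet_wflip_high:
  fixes x :: walsh_group
  assumes "x s = 1" "s < j"
  shows "walsh_dirichlet n (wflip j x) = (if bit n j then - walsh_dirichlet n x else walsh_dirichlet n x)"
proof -
  let ?q = "2 ^ Suc s * (n div 2 ^ Suc s)" and ?r = "n mod 2 ^ Suc s"
  have bit: "bit ?q j \<longleftrightarrow> bit n j"
  proof -
    have "?q = push_bit (Suc s) (drop_bit (Suc s) n)"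
      by (simp add: push_bit_eq_mult drop_bit_eq_div del: power_Suc)
    then show ?thesis using assms(2) by (simp add: bit_push_bit_iff bit_drop_bit_eq del: push_bit_Suc drop_bit_Suc power_Suc)
  qed
  have "(2::nat) ^ Suc s \<le> 2 ^ j" using assms(2) by (intro power_increasing) auto
  then have r: "?r \<le> 2 ^ j" 
    by (intro order_trans[OF less_imp_le[OF mod_less_divisor]]) simp_all
  have "wflip j x s = 1" using assms by (simp add: wflip_def)
  then have "walsh_dirichlet n (wflip j x) = walsh ?q (wflip j x) * walsh_dirichlet ?r (wflip j x)"
    by (intro walsh_dirichlet_reduce) simp
  also have "\<dots> = (if bit n j then - walsh ?q x else walsh ?q x) * walsh_dirichlet ?r x"
    by (simp only: walsh_wflip bit walsh_dirichlet_wflip[OF r])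
  finally show ?thesis
    using walsh_dirichlet_reduce[of x s n] assms(1) by simp
qed

text \<open>Different blocks mean that \<open>b\<close> and \<open>b'\<close> differ in some digit
  \<open>j > s\<close>. Flipping coordinate \<open>j\<close> preserves the level and changes the
  sign of exactly one factor, so the sum equals its own negative.\<close>

lemma walsh_dirichlet_orthogonal:
  assumes "s \<le> N" "b < 2 ^ N" "b' < 2 ^ N" "b div 2 ^ Suc s \<noteq> b' div 2 ^ Suc s"
  shows "(\<Sum>y\<in>walsh_level N s. walsh_dirichlet b y * walsh_dirichlet b' y) = 0"
proof -
  from assms(4) obtain k where "bit (b div 2 ^ Suc s) k \<noteq> bit (b' div 2 ^ Suc s) k"
    by (metis bit_eqI)
  then have bits: "bit b (Suc s + k) \<noteq> bit b' (Suc s + k)"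
    unfolding drop_bit_eq_div[symmetric] by (simp add: bit_drop_bit_eq)
  define j where "j = Suc s + k"
  \<comment> \<open>One of the two numbers has digit \<open>j\<close>, and both are below 2^N. Hence
    s < j < N, so points of the level do carry a 1 at \<open>s\<close>.\<close>
  have "(2::nat) ^ j < 2 ^ N"
    using bits bit_less_power[of b j] bit_less_power[of b' j] assms(2,3) unfolding j_def by fastforce
  then have j: "s < j" "j < N" by (auto simp: j_def simp del: power_Suc)
  have mem: "wflip j y \<in> walsh_level N s" if "y \<in> walsh_level N s" for y
    using that j by (auto simp: walsh_level_def walsh_points_def wflip_def)
  let ?S = "\<Sum>y\<in>walsh_level N s. walsh_dirichlet b y * walsh_dirichlet b' y"
  have "?S = (\<Sum>y\<in>walsh_level N s. walsh_dirichlet b (wflip j y) * walsh_dirichlet b' (wflip j y))"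
    by (rule sum.reindex_bij_witness[of _ "wflip j" "wflip j"]) (simp_all add: mem)
  also have "\<dots> = (\<Sum>y\<in>walsh_level N s. - (walsh_dirichlet b y * walsh_dirichlet b' y))"
  proof (rule sum.cong[OF refl])
    fix y assume "y \<in> walsh_level N s"
    then have "y s = 1" using j by (auto simp: walsh_level_def)
    from walsh_dirichlet_wflip_high[of y s j, OF this j(1)] bits
    show "walsh_dirichlet b (wflip j y) * walsh_dirichlet b' (wflip j y)
        = - (walsh_dirichlet b y * walsh_dirichlet b' y)"
      by (auto simp: j_def)
  qed
  also have "\<dots> = - ?S" by (simp add: sum_negf)
  finally show ?thesis by simp
qed

text \<open>The map from a' to n - a' is injective and lands in one block of length
  \<open>m\<close>.\<close>

lemma card_div_eq_le:
  assumes "m > 0"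
  shows "card {a'\<in>{..<n}. (n - a') div m = q} \<le> (m::nat)"
proof -
  have "inj_on (\<lambda>a'. n - a') {a'\<in>{..<n}. (n - a') div m = q}"
    by (rule inj_onI) auto
  moreover have "(\<lambda>a'. n - a') ` {a'\<in>{..<n}. (n - a') div m = q} \<subseteq> {q * m..<q * m + m}"
  proof clarify
    fix a' assume "a' < n" "q = (n - a') div m"
    show "n - a' \<in> {(n - a') div m * m..<(n - a') div m * m + m}"
      using dividend_less_div_times[OF assms, of "n - a'"] by (simp add: add.commute)
  qed
  ultimately have "card {a'\<in>{..<n}. (n - a') div m = q} \<le> card {q * m..<q * m + m}"
    by (intro card_inj_on_le[of "\<lambda>a'. n - a'"]) auto
  then show ?thesis by simp
qed

text \<open>Expanding the square gives pairs (a, a'). Orthogonality removes those with n - a and n -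
  a' in different blocks of length 2^(t+1), which leaves at most n 2^(t+1) pairs instead of
  n^2.\<close>

lemma triangular_kernel_square_sum_le:
  assumes x: "x \<in> walsh_level N s" and st: "s \<le> N" "t \<le> N" and n: "n < 2 ^ N"
  shows "(\<Sum>y\<in>walsh_level N t. (triangular_kernel n x y)\<^sup>2)
    \<le> real (card (walsh_level N t)) * (2 ^ (2 * s + 3 * t + 5) * real n)"
proof -
  let ?D = walsh_dirichlet and ?L = "walsh_level N t"
  \<comment> \<open>Bound for one pair: two Dirichlet kernels in x of size at most 2^(s+1), and two
    in y of size at most 2^(t+1), summed over the level.\<close>
  define B :: real where "B = (2 ^ Suc s)\<^sup>2 * (real (card ?L) * (2 ^ Suc t)\<^sup>2)"
  have B0: "B \<ge> 0" by (simp add: B_def)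
  have "(\<Sum>y\<in>?L. (triangular_kernel n x y)\<^sup>2)
      = (\<Sum>y\<in>?L. \<Sum>a<n. \<Sum>a'<n. (?D a x * ?D a' x) * (?D (n - a) y * ?D (n - a') y))"
    by (simp add: triangular_kernel_def power2_eq_square sum_product algebra_simps)
  also have "\<dots> = (\<Sum>a<n. \<Sum>a'<n. (?D a x * ?D a' x) * (\<Sum>y\<in>?L. ?D (n - a) y * ?D (n - a') y))"
    by (subst sum.swap, rule sum.cong[OF refl], subst sum.swap, rule sum.cong[OF refl])
       (simp add: sum_distrib_left)
  also have "\<dots> \<le> (\<Sum>a<n. \<Sum>a'<n. if (n - a') div 2 ^ Suc t = (n - a) div 2 ^ Suc t then B else 0)"
  proof (intro sum_mono)
    fix a a' assume a: "a \<in> {..<n}" "a' \<in> {..<n}"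
    then have lt: "n - a < 2 ^ N" "n - a' < 2 ^ N" "a < 2 ^ N" "a' < 2 ^ N"
      using n by auto
    show "(?D a x * ?D a' x) * (\<Sum>y\<in>?L. ?D (n - a) y * ?D (n - a') y)
        \<le> (if (n - a') div 2 ^ Suc t = (n - a) div 2 ^ Suc t then B else 0)"
    proof (cases "(n - a') div 2 ^ Suc t = (n - a) div 2 ^ Suc t")
      case False
      then show ?thesis
        using walsh_dirichlet_orthogonal[OF st(2) lt(1,2)] by auto
    next
      case True
      have "\<bar>?D a x * ?D a' x\<bar> \<le> (2 ^ Suc s)\<^sup>2"
        unfolding abs_mult power2_eq_square
        using walsh_levelD[OF x st(1)] lt
        by (intro mult_mono abs_walsh_dirichlet_le_power) auto
      moreover have "\<bar>\<Sum>y\<in>?L. ?D (n - a) y * ?D (n - a') y\<bar> \<le> real (card ?L) * (2 ^ Suc t)\<^sup>2"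
      proof (rule order_trans[OF sum_abs sum_bounded_above])
        fix y assume y: "y \<in> ?L"
        show "\<bar>?D (n - a) y * ?D (n - a') y\<bar> \<le> (2 ^ Suc t)\<^sup>2"
          unfolding abs_mult power2_eq_square
          using walsh_levelD[OF y st(2)] lt
          by (intro mult_mono abs_walsh_dirichlet_le_power) auto
      qed
      ultimately have "\<bar>(?D a x * ?D a' x) * (\<Sum>y\<in>?L. ?D (n - a) y * ?D (n - a') y)\<bar> \<le> B"
        unfolding B_def abs_mult[of "?D a x * ?D a' x"] by (intro mult_mono) auto
      with True show ?thesis by simp
    qed
  qed
  also have "\<dots> = (\<Sum>a<n. real (card {a'\<in>{..<n}. (n - a') div 2 ^ Suc t = (n - a) div 2 ^ Suc t}) * B)"
    by (simp add: sum.If_cases Int_def del: power_Suc)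
  also have "\<dots> \<le> (\<Sum>a<n. 2 ^ Suc t * B)"
  proof (intro sum_mono mult_right_mono B0)
    fix a
    show "real (card {a'\<in>{..<n}. (n - a') div 2 ^ Suc t = (n - a) div 2 ^ Suc t}) \<le> 2 ^ Suc t"
      using of_nat_mono[OF card_div_eq_le[of "2 ^ Suc t" n "(n - a) div 2 ^ Suc t"], where 'a = real]
      by (simp del: power_Suc)
  qed
  also have "\<dots> = real (card ?L) * (2 ^ (2 * s + 3 * t + 5) * real n)"
  proof -
    have "2 ^ Suc t * ((2 ^ Suc s)\<^sup>2 * (2 ^ Suc t)\<^sup>2) = (2::real) ^ (Suc t + Suc s * 2 + Suc t * 2)"
      by (simp only: power_add power_mult mult.assoc)
    also have "Suc t + Suc s * 2 + Suc t * 2 = 2 * s + 3 * t + 5"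
      by simp
    finally show ?thesis
      by (simp add: B_def del: power_Suc)
  qed
  finally show ?thesis .
qed

text \<open>A replacement for Hoelder's inequality at the cost of a factor 2: u^(p/2) \<le> 1 + u is
  applied to u = g^2 / M and summed.\<close>

lemma sum_powr_le_of_square_sum_le:
  fixes g :: "'a \<Rightarrow> real"
  assumes "0 < p" "p \<le> 2" "0 < M" "(\<Sum>y\<in>L. (g y)\<^sup>2) \<le> real (card L) * M"
  shows "(\<Sum>y\<in>L. \<bar>g y\<bar> powr p) \<le> 2 * real (card L) * M powr (p / 2)"
proof -
  have "\<bar>g y\<bar> powr p \<le> M powr (p / 2) * (1 + (g y)\<^sup>2 / M)" for y
  proof -
    have pw: "b powr (p / 2) \<le> 1 + b" if "b \<ge> 0" for b :: real
    proof (cases "b \<le> 1")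
      case True
      then have "b powr (p / 2) \<le> 1" using assms(1) that by (intro powr_le1) auto
      then show ?thesis using that by simp
    next
      case False
      then have "b powr (p / 2) \<le> b powr 1" using assms(2) by (intro powr_mono) auto
      then show ?thesis using that by simp
    qed
    have "\<bar>g y\<bar> powr p = ((g y)\<^sup>2) powr (p / 2)"
      using powr_powr[of "\<bar>g y\<bar>" 2 "p / 2"] by (cases "g y = 0") simp_all
    also have "\<dots> = (M * ((g y)\<^sup>2 / M)) powr (p / 2)"
      using assms(3) by simp
    also have "\<dots> = M powr (p / 2) * ((g y)\<^sup>2 / M) powr (p / 2)"
      by (rule powr_mult)
    also have "\<dots> \<le> M powr (p / 2) * (1 + (g y)\<^sup>2 / M)"
      using assms(3) by (intro mult_left_mono pw) auto
    finally show ?thesis .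
  qed
  then have "(\<Sum>y\<in>L. \<bar>g y\<bar> powr p) \<le> (\<Sum>y\<in>L. M powr (p / 2) * (1 + (g y)\<^sup>2 / M))"
    by (rule sum_mono)
  also have "\<dots> = M powr (p / 2) * (real (card L) + (\<Sum>y\<in>L. (g y)\<^sup>2) / M)"
    by (simp add: sum_distrib_left[symmetric] sum.distrib sum_divide_distrib)
  also have "\<dots> \<le> M powr (p / 2) * (real (card L) + real (card L))"
    using assms(3,4) by (intro mult_left_mono add_left_mono) (auto simp: field_simps)
  finally show ?thesis by (simp add: algebra_simps)
qed


text \<open>The powers \<open>N - s\<close> and \<open>s - t\<close> come from rewriting the exponent
  \<open>2N - s - t + (p/2)(2s + 3t + N) - 3Np\<close>.\<close>

lemma level_block_bound:
  assumes p: "0 < p" "p \<le> 1" and st: "t \<le> s" "s \<le> N" and n: "n < 2 ^ N" "2 ^ N \<le> 2 * n"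
  shows "(\<Sum>x\<in>walsh_level N s. \<Sum>y\<in>walsh_level N t. \<bar>triangular_kernel n x y\<bar> powr p)
    \<le> 2 * 8 powr p * (real n * 4 ^ N) powr p
        * ((2 powr (2 - 5 * p / 2)) ^ (N - s) * (2 powr (1 - 3 * p / 2)) ^ (s - t))"
proof -
  let ?M = "2 ^ (2 * s + 3 * t + 5) * real n"
  have n0: "n > 0" using n(2) by (cases n) auto
  have "(\<Sum>x\<in>walsh_level N s. \<Sum>y\<in>walsh_level N t. \<bar>triangular_kernel n x y\<bar> powr p)
      \<le> (\<Sum>x\<in>walsh_level N s. 2 * real (card (walsh_level N t)) * ?M powr (p / 2))"
    using p st n n0 by (intro sum_mono sum_powr_le_of_square_sum_le triangular_kernel_square_sum_le) auto
  also have "\<dots> = real (card (walsh_level N s)) * (2 * real (card (walsh_level N t)) * ?M powr (p / 2))"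
    by simp
  also have "\<dots> \<le> 2 ^ (N - s) * (2 * 2 ^ (N - t) * ?M powr (p / 2))"
    using of_nat_mono[OF card_walsh_level_le[of N s], where 'a = real]
      of_nat_mono[OF card_walsh_level_le[of N t], where 'a = real]
    by (intro mult_mono) auto
  also have "?M powr (p / 2) = 2 powr (real (2 * s + 3 * t + 5) * (p / 2)) * (real n powr p * real n powr (- (p / 2)))"
    using n0 by (simp add: powr_mult powr_powr powr_add[symmetric] flip: powr_realpow)
  \<comment> \<open>The power n^p is kept for the normalization; the surplus n^(-p/2) becomes a
    power of 2 by n \<ge> 2^(N-1), the negative exponent reversing the inequality.\<close>
  also have "\<dots> \<le> 2 powr (real (2 * s + 3 * t + 5) * (p / 2)) * (real n powr p * 2 powr (- (p / 2) * (real N - 1)))"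
  proof (intro mult_left_mono)
    have "(2::real) powr (real N - 1) \<le> real n"
      using of_nat_mono[OF n(2), where 'a = real] by (simp add: powr_diff powr_realpow)
    then have "real n powr (- (p / 2)) \<le> (2 powr (real N - 1)) powr (- (p / 2))"
      using p by (intro powr_mono2') auto
    then show "real n powr (- (p / 2)) \<le> 2 powr (- (p / 2) * (real N - 1))"
      by (simp add: powr_powr mult.commute)
  qed auto
  also have "2 ^ (N - s) * (2 * 2 ^ (N - t) * (2 powr (real (2 * s + 3 * t + 5) * (p / 2)) * (real n powr p * 2 powr (- (p / 2) * (real N - 1)))))
      = 2 * real n powr p * 2 powr (real (N - s) + (real (N - t) + (real (2 * s + 3 * t + 5) * (p / 2) + - (p / 2) * (real N - 1))))"
    by (simp only: powr_add powr_realpow zero_less_numeral mult_ac)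
  \<comment> \<open>The constants 5p/2 and p/2 combine to 3p, hence the factor 8^p; the part 2Np is
    set aside as (4^N)^p.\<close>
  also have "real (N - s) + (real (N - t) + (real (2 * s + 3 * t + 5) * (p / 2) + - (p / 2) * (real N - 1)))
      = 3 * p + (2 * real N * p + ((2 - 5 * p / 2) * real (N - s) + (1 - 3 * p / 2) * real (s - t)))"
    using st by (simp add: of_nat_diff field_simps)
  also have "2 * real n powr p * 2 powr \<dots> = 2 * 2 powr (3 * p) * (real n powr p * 2 powr (2 * real N * p))
      * (2 powr ((2 - 5 * p / 2) * real (N - s)) * 2 powr ((1 - 3 * p / 2) * real (s - t)))"
    by (simp only: powr_add mult_ac)
  also have "2 powr (3 * p) = (8::real) powr p"
    using powr_powr[of 2 3 p] by simp
  also have "2 powr (2 * real N * p) = ((4::real) ^ N) powr p"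
  proof -
    have "(4::real) ^ N = 2 powr (2 * real N)"
      using powr_powr[of 2 2 "real N"] by (simp add: powr_realpow)
    then show ?thesis by (simp add: powr_powr)
  qed
  also have "real n powr p * (4 ^ N) powr p = (real n * 4 ^ N) powr p"
    by (simp add: powr_mult)
  also have "2 powr ((2 - 5 * p / 2) * real (N - s)) = ((2::real) powr (2 - 5 * p / 2)) ^ (N - s)"
    by (simp add: powr_powr[symmetric] powr_realpow)
  also have "2 powr ((1 - 3 * p / 2) * real (s - t)) = ((2::real) powr (1 - 3 * p / 2)) ^ (s - t)"
    by (simp add: powr_powr[symmetric] powr_realpow)
  \<comment> \<open>The bound on n^(-p/2) was used inside a product, so monotonicity of that product
    remains to be checked.\<close>
  finally show ?thesis
    by this (intro mult_left_mono, auto)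
qed

text \<open>Distinct exponents select part of the geometric series. The injection \<open>h\<close>
  allows for the exponents \<open>N - s\<close> and \<open>s - t\<close>.\<close>

lemma sum_power_le_inverse:
  fixes q :: real
  assumes "0 \<le> q" "q < 1" "finite A" "inj_on h A"
  shows "(\<Sum>s\<in>A. q ^ h s) \<le> 1 / (1 - q)"
proof -
  have "(\<Sum>s\<in>A. q ^ h s) = (\<Sum>k\<in>h ` A. q ^ k)"
    using assms by (simp add: sum.reindex)
  also have "\<dots> \<le> (\<Sum>k. q ^ k)"
    using assms by (intro sum_le_suminf summable_geometric) auto
  also have "\<dots> = 1 / (1 - q)"
    using assms by (intro suminf_geometric) auto
  finally show ?thesis .
qed

text \<open>The product of the two geometric series; the 4 is the 2 of
  \<open>level_block_bound\<close> times 2 for the two orders of \<open>s\<close> and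
  \<open>t\<close>.\<close>

definition kernel_bound :: "real \<Rightarrow> real" where
  "kernel_bound p = 4 * 8 powr p / ((1 - 2 powr (2 - 5 * p / 2)) * (1 - 2 powr (1 - 3 * p / 2)))"

lemma triangular_kernel_powr_sum_le:
  assumes p: "4 / 5 < p" "p \<le> 1" and n: "n < 2 ^ N" "2 ^ N \<le> 2 * n"
  shows "(\<Sum>x\<in>walsh_points {..<N}. \<Sum>y\<in>walsh_points {..<N}. \<bar>triangular_kernel n x y\<bar> powr p)
    \<le> kernel_bound p * (real n * 4 ^ N) powr p"
proof -
  define q1 :: real where "q1 = 2 powr (2 - 5 * p / 2)"
  define q2 :: real where "q2 = 2 powr (1 - 3 * p / 2)"
  \<comment> \<open>\<open>q1 < 1\<close> is the condition p > 4/5; \<open>q2 < 1\<close> amounts to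
    p > 2/3.\<close>
  have q: "0 < q1" "q1 < 1" "0 < q2" "q2 < 1"
    using p powr_less_mono[of "2 - 5 * p / 2" 0 2] powr_less_mono[of "1 - 3 * p / 2" 0 2]
    by (auto simp: q1_def q2_def)
  define T where "T s t = (\<Sum>x\<in>walsh_level N s. \<Sum>y\<in>walsh_level N t. \<bar>triangular_kernel n x y\<bar> powr p)" for s t
  define W where "W = 2 * 8 powr p * (real n * 4 ^ N) powr p"
  have W0: "W \<ge> 0" by (simp add: W_def)
  have T0: "T s t \<ge> 0" for s t by (simp add: T_def sum_nonneg)
  have T_commute: "T s t = T t s" for s t
    unfolding T_def by (subst sum.swap) (simp add: triangular_kernel_commute)
  have T_le: "T s t \<le> W * (q1 ^ (N - s) * q2 ^ (s - t))" if "t \<le> s" "s \<le> N" for s t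
    unfolding T_def W_def q1_def q2_def using p n that by (intro level_block_bound) auto
  have "(\<Sum>x\<in>walsh_points {..<N}. \<Sum>y\<in>walsh_points {..<N}. \<bar>triangular_kernel n x y\<bar> powr p)
      = (\<Sum>s\<le>N. \<Sum>t\<le>N. T s t)"
    unfolding T_def sum_walsh_points_levels by (intro sum.cong refl sum.swap)
  \<comment> \<open>The diagonal is counted twice, which is harmless for nonnegative terms and makes
    the two halves equal by symmetry.\<close>
  also have "\<dots> \<le> (\<Sum>s\<le>N. \<Sum>t\<le>N. (if t \<le> s then T s t else 0) + (if s \<le> t then T s t else 0))"
    using T0 by (intro sum_mono) auto
  also have "\<dots> = (\<Sum>s\<le>N. \<Sum>t\<le>N. if t \<le> s then T s t else 0) + (\<Sum>s\<le>N. \<Sum>t\<le>N. if s \<le> t then T s t else 0)"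
    by (simp add: sum.distrib)
  also have "(\<Sum>s\<le>N. \<Sum>t\<le>N. if s \<le> t then T s t else 0) = (\<Sum>s\<le>N. \<Sum>t\<le>N. if t \<le> s then T s t else 0)"
    by (subst sum.swap) (simp add: T_commute cong: if_cong)
  also have "(\<Sum>s\<le>N. \<Sum>t\<le>N. if t \<le> s then T s t else 0) = (\<Sum>s\<le>N. \<Sum>t\<le>s. T s t)"
    by (intro sum.cong refl sum.mono_neutral_cong_right) auto
  also have "(\<Sum>s\<le>N. \<Sum>t\<le>s. T s t) \<le> (\<Sum>s\<le>N. W * (q1 ^ (N - s) * (1 / (1 - q2))))"
  proof (rule sum_mono)
    fix s assume s: "s \<in> {..N}"
    have "(\<Sum>t\<le>s. T s t) \<le> (\<Sum>t\<le>s. W * (q1 ^ (N - s) * q2 ^ (s - t)))"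
      using s by (intro sum_mono T_le) auto
    also have "\<dots> = W * (q1 ^ (N - s) * (\<Sum>t\<le>s. q2 ^ (s - t)))"
      by (simp add: sum_distrib_left)
    also have "\<dots> \<le> W * (q1 ^ (N - s) * (1 / (1 - q2)))"
      using q W0 by (intro mult_left_mono sum_power_le_inverse) (auto intro: inj_onI)
    finally show "(\<Sum>t\<le>s. T s t) \<le> W * (q1 ^ (N - s) * (1 / (1 - q2)))" .
  qed
  also have "(\<Sum>s\<le>N. W * (q1 ^ (N - s) * (1 / (1 - q2)))) = W * (1 / (1 - q2)) * (\<Sum>s\<le>N. q1 ^ (N - s))"
    by (simp add: sum_distrib_left mult_ac)
  also have "\<dots> \<le> W * (1 / (1 - q2)) * (1 / (1 - q1))"
    using q W0 by (intro mult_left_mono sum_power_le_inverse) (auto intro: inj_onI)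
  finally show ?thesis
    using q unfolding kernel_bound_def q1_def[symmetric] q2_def[symmetric]
    by (simp add: W_def field_simps)
qed

lemma kernel_bound_nonneg:
  assumes "4 / 5 < p" shows "kernel_bound p \<ge> 0"
proof -
  have "(2::real) powr (2 - 5 * p / 2) < 1" "(2::real) powr (1 - 3 * p / 2) < 1"
    using assms powr_less_mono[of "2 - 5 * p / 2" 0 2] powr_less_mono[of "1 - 3 * p / 2" 0 2] by auto
  then show ?thesis by (simp add: kernel_bound_def)
qed

section \<open>Kernel operators on finite sets\<close>

text \<open>After division by the sum, all terms lie in [0, 1], where u \<le> u^p.\<close>

lemma powr_sum_subadditive:
  fixes a :: "'a \<Rightarrow> real"
  assumes "finite A" "0 < p" "p \<le> 1" "\<And>i. i \<in> A \<Longrightarrow> 0 \<le> a i"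
  shows "(\<Sum>i\<in>A. a i) powr p \<le> (\<Sum>i\<in>A. a i powr p)"
proof (cases "(\<Sum>i\<in>A. a i) = 0")
  case True
  then show ?thesis by (simp add: sum_nonneg)
next
  case False
  define S where "S = (\<Sum>i\<in>A. a i)"
  have S: "S > 0" 
    using False sum_nonneg[of A a] assms(4) unfolding S_def by (metis less_eq_real_def)
  have "1 = (\<Sum>i\<in>A. a i / S)"
    using S by (simp add: sum_divide_distrib[symmetric] S_def)
  also have "\<dots> \<le> (\<Sum>i\<in>A. (a i / S) powr p)"
  proof (rule sum_mono)
    fix i assume i: "i \<in> A"
    have "a i \<le> S" unfolding S_def using assms i by (intro member_le_sum) auto
    then have "a i / S \<le> 1" "0 \<le> a i / S" using S assms(4)[OF i] by auto
    then show "a i / S \<le> (a i / S) powr p"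
      using powr_mono'[of p 1 "a i / S"] assms(3) powr_one[of "a i / S"] by argo
  qed
  also have "\<dots> = (\<Sum>i\<in>A. a i powr p) / S powr p"
    using S assms(4) by (simp add: powr_divide sum_divide_distrib)
  finally show ?thesis
    using S by (simp add: S_def[symmetric] field_simps)
qed

text \<open>Jensen's inequality with weights \<open>w i / S\<close>, restricted to the indices with
  \<open>g i > 0\<close> so that convexity on the positive half-line suffices. The remaining indices
  contribute 0 to both sums of products.\<close>

lemma weighted_power_mean:
  fixes w g :: "'a \<Rightarrow> real"
  assumes "finite A" "1 \<le> p" "\<And>i. i \<in> A \<Longrightarrow> 0 \<le> w i" "\<And>i. i \<in> A \<Longrightarrow> 0 \<le> g i"
  shows "(\<Sum>i\<in>A. w i * g i) powr p \<le> (\<Sum>i\<in>A. w i) powr (p - 1) * (\<Sum>i\<in>A. w i * g i powr p)"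
proof -
  define P where "P = {i\<in>A. g i > 0}"
  define S where "S = (\<Sum>i\<in>P. w i)"
  have P: "finite P" "P \<subseteq> A" using assms(1) by (auto simp: P_def)
  have g0: "g i = 0" if "i \<in> A - P" for i
    using that assms(4)[of i] by (auto simp: P_def)
  have eq: "(\<Sum>i\<in>A. w i * g i) = (\<Sum>i\<in>P. w i * g i)" "(\<Sum>i\<in>A. w i * g i powr p) = (\<Sum>i\<in>P. w i * g i powr p)"
    using P assms(1) g0 by (auto intro!: sum.mono_neutral_right)
  have nonneg: "0 \<le> (\<Sum>i\<in>P. w i * g i powr p)"
    using P assms by (intro sum_nonneg) auto
  show ?thesis
  proof (cases "S = 0")
    case True
    then have "\<forall>i\<in>P. w i = 0"
      unfolding S_def using P assms(3) by (subst (asm) sum_nonneg_eq_0_iff) auto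
    then show ?thesis unfolding eq by simp
  next
    case False
    then have S: "S > 0"
      unfolding S_def using P assms(3) by (metis less_eq_real_def subsetD sum_nonneg)
    have "(\<Sum>i\<in>P. (w i / S) *\<^sub>R g i) powr p \<le> (\<Sum>i\<in>P. (w i / S) * g i powr p)"
    proof (rule convex_on_sum[OF P(1) _ powr_convex[OF assms(2)]])
      show "P \<noteq> {}" using False by (auto simp: S_def)
      show "(\<Sum>i\<in>P. w i / S) = 1" using S by (simp add: sum_divide_distrib[symmetric] S_def)
    qed (use P S assms(3) in \<open>auto simp: P_def\<close>)
    also have "(\<Sum>i\<in>P. (w i / S) *\<^sub>R g i) = (\<Sum>i\<in>P. w i * g i) / S"
      by (simp add: sum_divide_distrib)
    also have "\<dots> powr p = (\<Sum>i\<in>P. w i * g i) powr p / S powr p"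
      by (rule powr_divide)
    also have "(\<Sum>i\<in>P. (w i / S) * g i powr p) = (\<Sum>i\<in>P. w i * g i powr p) / S"
      by (simp add: sum_divide_distrib)
    finally have "(\<Sum>i\<in>P. w i * g i) powr p \<le> (S powr p / S) * (\<Sum>i\<in>P. w i * g i powr p)"
      using S by (simp add: field_simps)
    also have "S powr p / S = S powr (p - 1)"
      using S by (simp add: powr_diff)
    also have "S powr (p - 1) * (\<Sum>i\<in>P. w i * g i powr p) \<le> (\<Sum>i\<in>A. w i) powr (p - 1) * (\<Sum>i\<in>P. w i * g i powr p)"
    proof (intro mult_right_mono nonneg powr_mono2)
      show "S \<le> (\<Sum>i\<in>A. w i)" unfolding S_def using P assms by (intro sum_mono2) auto
    qed (use S assms(2) in auto)
    finally show ?thesis unfolding eq .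
  qed
qed

text \<open>The p-triangle inequality moves the power inside the sum; after exchanging the sums only
  column sums of p-th powers of the kernel are left.\<close>

lemma kernel_operator_bound_le_1:
  fixes f :: "'a \<Rightarrow> complex" and k :: "'b \<Rightarrow> 'a \<Rightarrow> real"
  assumes "finite A" "0 < p" "p \<le> 1" "\<And>c. c \<in> A \<Longrightarrow> (\<Sum>z\<in>Z. \<bar>k z c\<bar> powr p) \<le> B"
  shows "(\<Sum>z\<in>Z. cmod (\<Sum>c\<in>A. f c * of_real (k z c)) powr p) \<le> B * (\<Sum>c\<in>A. cmod (f c) powr p)"
proof -
  have "(\<Sum>z\<in>Z. cmod (\<Sum>c\<in>A. f c * of_real (k z c)) powr p)
      \<le> (\<Sum>z\<in>Z. \<Sum>c\<in>A. cmod (f c) powr p * \<bar>k z c\<bar> powr p)"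
  proof (rule sum_mono)
    fix z
    have "cmod (\<Sum>c\<in>A. f c * of_real (k z c)) powr p \<le> (\<Sum>c\<in>A. cmod (f c) * \<bar>k z c\<bar>) powr p"
      using assms(2) by (intro powr_mono2 order_trans[OF norm_sum]) (simp_all add: norm_mult)
    also have "\<dots> \<le> (\<Sum>c\<in>A. (cmod (f c) * \<bar>k z c\<bar>) powr p)"
      using assms by (intro powr_sum_subadditive) auto
    finally show "cmod (\<Sum>c\<in>A. f c * of_real (k z c)) powr p \<le> (\<Sum>c\<in>A. cmod (f c) powr p * \<bar>k z c\<bar> powr p)"
      by (simp add: powr_mult)
  qed
  also have "\<dots> = (\<Sum>c\<in>A. cmod (f c) powr p * (\<Sum>z\<in>Z. \<bar>k z c\<bar> powr p))"
    by (subst sum.swap) (simp add: sum_distrib_left)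
  also have "\<dots> \<le> (\<Sum>c\<in>A. cmod (f c) powr p * B)"
    using assms(4) by (intro sum_mono mult_left_mono) auto
  finally show ?thesis by (simp add: sum_distrib_left mult.commute)
qed

text \<open>The Schur test: Jensen's inequality turns the row sums into B^(p-1), and exchanging the
  sums gives the last factor B from the column sums.\<close>

lemma kernel_operator_bound_ge_1:
  fixes f :: "'a \<Rightarrow> complex" and k :: "'b \<Rightarrow> 'a \<Rightarrow> real"
  assumes "finite A" "1 \<le> p" "0 \<le> B"
    and "\<And>c. c \<in> A \<Longrightarrow> (\<Sum>z\<in>Z. \<bar>k z c\<bar>) \<le> B" "\<And>z. z \<in> Z \<Longrightarrow> (\<Sum>c\<in>A. \<bar>k z c\<bar>) \<le> B"
  shows "(\<Sum>z\<in>Z. cmod (\<Sum>c\<in>A. f c * of_real (k z c)) powr p) \<le> B powr p * (\<Sum>c\<in>A. cmod (f c) powr p)"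
proof -
  have "(\<Sum>z\<in>Z. cmod (\<Sum>c\<in>A. f c * of_real (k z c)) powr p)
      \<le> (\<Sum>z\<in>Z. B powr (p - 1) * (\<Sum>c\<in>A. \<bar>k z c\<bar> * cmod (f c) powr p))"
  proof (rule sum_mono)
    fix z assume z: "z \<in> Z"
    have "cmod (\<Sum>c\<in>A. f c * of_real (k z c)) powr p \<le> (\<Sum>c\<in>A. \<bar>k z c\<bar> * cmod (f c)) powr p"
      using assms(2) by (intro powr_mono2 order_trans[OF norm_sum]) (simp_all add: norm_mult mult.commute)
    also have "\<dots> \<le> (\<Sum>c\<in>A. \<bar>k z c\<bar>) powr (p - 1) * (\<Sum>c\<in>A. \<bar>k z c\<bar> * cmod (f c) powr p)"
      using assms(1,2) by (intro weighted_power_mean) auto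
    also have "\<dots> \<le> B powr (p - 1) * (\<Sum>c\<in>A. \<bar>k z c\<bar> * cmod (f c) powr p)"
      using assms z by (intro mult_right_mono powr_mono2 sum_nonneg) auto
    finally show "cmod (\<Sum>c\<in>A. f c * of_real (k z c)) powr p \<le> B powr (p - 1) * (\<Sum>c\<in>A. \<bar>k z c\<bar> * cmod (f c) powr p)" .
  qed
  also have "\<dots> = B powr (p - 1) * (\<Sum>c\<in>A. cmod (f c) powr p * (\<Sum>z\<in>Z. \<bar>k z c\<bar>))"
    unfolding sum_distrib_left[symmetric] by (subst sum.swap) (simp add: sum_distrib_left mult_ac)
  also have "\<dots> \<le> B powr (p - 1) * (\<Sum>c\<in>A. cmod (f c) powr p * B)"
    using assms(4) by (intro mult_left_mono sum_mono) auto
  also have "\<dots> = (B powr (p - 1) * B) * (\<Sum>c\<in>A. cmod (f c) powr p)"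
    by (simp add: sum_distrib_left mult_ac)
  also have "B powr (p - 1) * B = B powr p"
    using assms(2,3) by (cases "B = 0") (simp_all add: powr_diff)
  finally show ?thesis .
qed

section \<open>Functions constant on dyadic squares\<close>

definition walsh_trunc :: "nat \<Rightarrow> walsh_group \<Rightarrow> walsh_group" where
  "walsh_trunc N x = (\<lambda>k. if k < N then x k else 0)"

abbreviation square_points :: "nat \<Rightarrow> (walsh_group \<times> walsh_group) set" where
  "square_points N \<equiv> walsh_points {..<N} \<times> walsh_points {..<N}"

lemma walsh_trunc_in_points [simp]: "walsh_trunc N x \<in> walsh_points {..<N}"
  by (simp add: walsh_trunc_def walsh_points_def)

lemma dyadic_interval_iff_trunc:
  assumes "r \<in> walsh_points {..<N}"
  shows "x \<in> dyadic_interval N r \<longleftrightarrow> walsh_trunc N x = r"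
  using assms by (auto simp: dyadic_interval_def walsh_trunc_def walsh_points_def fun_eq_iff)

lemma sets_dyadic_interval [measurable]: "dyadic_interval N r \<in> sets walsh_haar"
  and emeasure_dyadic_interval: "emeasure walsh_haar (dyadic_interval N r) = ennreal (1 / 2 ^ N)"
proof -
  let ?U = "uniform_count_measure (UNIV :: bit set)"
  interpret product_prob_space "\<lambda>_::nat. ?U" UNIV
    by (intro product_prob_spaceI prob_space_coordinate)
  have fin: "finite (UNIV :: bit set)" "card (UNIV :: bit set) = 2"
    by (simp_all add: UNIV_bit)
  have eq: "dyadic_interval N r = prod_emb UNIV (\<lambda>_. ?U) {..<N} (\<Pi>\<^sub>E k\<in>{..<N}. {r k})"
    by (rule set_eqI) (simp add: dyadic_interval_def prod_emb_def space_PiM space_uniform_count_measure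
      PiE_UNIV_domain PiE_iff lessThan_def del: PiE_singleton)
  show "dyadic_interval N r \<in> sets walsh_haar"
    unfolding eq walsh_haar_def by (intro sets_PiM_I) (auto simp: sets_uniform_count_measure)
  have "emeasure walsh_haar (dyadic_interval N r) = (\<Prod>k\<in>{..<N}. emeasure ?U {r k})"
    unfolding eq walsh_haar_def by (intro emeasure_PiM_emb) (auto simp: sets_uniform_count_measure)
  also have "\<dots> = (\<Prod>k\<in>{..<N}. ennreal (1 / 2))"
    by (intro prod.cong refl) (simp add: emeasure_uniform_count_measure[OF fin(1)] fin(2))
  also have "\<dots> = ennreal (1 / 2 ^ N)"
    unfolding prod_constant card_lessThan by (subst ennreal_power) (simp_all add: power_one_over)
  finally show "emeasure walsh_haar (dyadic_interval N r) = ennreal (1 / 2 ^ N)" .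
qed

lemma emeasure_dyadic_square:
  "emeasure walsh_haar2 (dyadic_interval N r \<times> dyadic_interval N s) = ennreal (1 / 4 ^ N)"
proof -
  interpret prob_space walsh_haar by (rule prob_space_walsh_haar)
  show ?thesis
    by (subst emeasure_pair_measure_Times)
       (simp_all add: emeasure_dyadic_interval ennreal_mult[symmetric] power_mult_distrib[symmetric])
qed

text \<open>A pointwise form of measurability with respect to \<open>dyadic_filtration N\<close>; it
  turns integrals into finite sums over representatives of the squares.\<close>

definition dyadic_constant :: "nat \<Rightarrow> (walsh_group \<times> walsh_group \<Rightarrow> 'a) \<Rightarrow> bool" where
  "dyadic_constant N g \<longleftrightarrow> (\<forall>x y. g (x, y) = g (walsh_trunc N x, walsh_trunc N y))"

lemma dyadic_square_indicator:
  assumes "c \<in> square_points N"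
  shows "indicator (dyadic_interval N (fst c) \<times> dyadic_interval N (snd c)) (x, y)
    = (if c = (walsh_trunc N x, walsh_trunc N y) then 1 else 0 :: 'a :: zero_neq_one)"
  using assms by (cases c) (auto simp: indicator_def dyadic_interval_iff_trunc)

lemma dyadic_constant_expand:
  fixes g :: "walsh_group \<times> walsh_group \<Rightarrow> complex"
  assumes "dyadic_constant N g"
  shows "g = (\<lambda>z. \<Sum>c\<in>square_points N. indicator (dyadic_interval N (fst c) \<times> dyadic_interval N (snd c)) z *\<^sub>R g c)"
proof
  fix z :: "walsh_group \<times> walsh_group"
  obtain x y where z: "z = (x, y)" by (cases z)
  have "(\<Sum>c\<in>square_points N. indicator (dyadic_interval N (fst c) \<times> dyadic_interval N (snd c)) z *\<^sub>R g c)
      = (\<Sum>c\<in>square_points N. if c = (walsh_trunc N x, walsh_trunc N y) then g c else 0)"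
    unfolding z by (intro sum.cong refl) (simp add: dyadic_square_indicator)
  also have "\<dots> = g z"
    using assms by (simp add: sum.delta' z dyadic_constant_def)
  finally show "g z = (\<Sum>c\<in>square_points N. indicator (dyadic_interval N (fst c) \<times> dyadic_interval N (snd c)) z *\<^sub>R g c)" ..
qed

lemma dyadic_constant_expand_ennreal:
  fixes g :: "walsh_group \<times> walsh_group \<Rightarrow> ennreal"
  assumes "dyadic_constant N g"
  shows "g = (\<lambda>z. \<Sum>c\<in>square_points N. g c * indicator (dyadic_interval N (fst c) \<times> dyadic_interval N (snd c)) z)"
proof
  fix z :: "walsh_group \<times> walsh_group"
  obtain x y where z: "z = (x, y)" by (cases z)
  have "(\<Sum>c\<in>square_points N. g c * indicator (dyadic_interval N (fst c) \<times> dyadic_interval N (snd c)) z)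
      = (\<Sum>c\<in>square_points N. if c = (walsh_trunc N x, walsh_trunc N y) then g c else 0)"
    unfolding z by (intro sum.cong refl) (simp add: dyadic_square_indicator)
  also have "\<dots> = g z"
    using assms by (simp add: sum.delta' z dyadic_constant_def)
  finally show "g z = (\<Sum>c\<in>square_points N. g c * indicator (dyadic_interval N (fst c) \<times> dyadic_interval N (snd c)) z)" ..
qed

lemma sets_dyadic_square: "dyadic_interval N x \<times> dyadic_interval N y \<in> sets walsh_haar2"
  by (intro pair_measureI sets_dyadic_interval)

lemma integral_dyadic_constant:
  fixes g :: "walsh_group \<times> walsh_group \<Rightarrow> complex"
  assumes "dyadic_constant N g"
  shows "(LINT z|walsh_haar2. g z) = (\<Sum>c\<in>square_points N. g c) / 4 ^ N"
proof -
  have "has_bochner_integral walsh_haar2 g (\<Sum>c\<in>square_points N. measure walsh_haar2 (dyadic_interval N (fst c) \<times> dyadic_interval N (snd c)) *\<^sub>R g c)"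
    by (subst dyadic_constant_expand[OF assms], intro has_bochner_integral_sum has_bochner_integral_indicator sets_dyadic_square)
       (simp add: emeasure_dyadic_square)
  then have "(LINT z|walsh_haar2. g z) = (\<Sum>c\<in>square_points N. measure walsh_haar2 (dyadic_interval N (fst c) \<times> dyadic_interval N (snd c)) *\<^sub>R g c)"
    by (rule has_bochner_integral_integral_eq)
  also have "\<dots> = (\<Sum>c\<in>square_points N. g c / 4 ^ N)"
    by (intro sum.cong refl) (simp add: measure_def emeasure_dyadic_square scaleR_conv_of_real)
  finally show ?thesis by (simp add: sum_divide_distrib)
qed

lemma measurable_dyadic_constant:
  fixes g :: "walsh_group \<times> walsh_group \<Rightarrow> ennreal"
  assumes "dyadic_constant N g"
  shows "g \<in> borel_measurable walsh_haar2"
  by (subst dyadic_constant_expand_ennreal[OF assms])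
     (intro borel_measurable_sum borel_measurable_times_ennreal borel_measurable_const borel_measurable_indicator sets_dyadic_square)

lemma nn_integral_dyadic_constant:
  fixes g :: "walsh_group \<times> walsh_group \<Rightarrow> ennreal"
  assumes "dyadic_constant N g"
  shows "(\<integral>\<^sup>+z. g z \<partial>walsh_haar2) = (\<Sum>c\<in>square_points N. g c) * ennreal (1 / 4 ^ N)"
proof -
  have "(\<integral>\<^sup>+z. g z \<partial>walsh_haar2) = (\<integral>\<^sup>+z. (\<Sum>c\<in>square_points N. g c * indicator (dyadic_interval N (fst c) \<times> dyadic_interval N (snd c)) z) \<partial>walsh_haar2)"
    by (subst dyadic_constant_expand_ennreal[OF assms]) (rule refl)
  also have "\<dots> = (\<Sum>c\<in>square_points N. \<integral>\<^sup>+z. g c * indicator (dyadic_interval N (fst c) \<times> dyadic_interval N (snd c)) z \<partial>walsh_haar2)"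
    by (intro nn_integral_sum borel_measurable_times_ennreal borel_measurable_const borel_measurable_indicator sets_dyadic_square)
  also have "\<dots> = (\<Sum>c\<in>square_points N. g c * ennreal (1 / 4 ^ N))"
    by (intro sum.cong refl) (simp only: nn_integral_cmult_indicator[OF sets_dyadic_square] emeasure_dyadic_square)
  finally show ?thesis by (simp add: sum_distrib_right)
qed

text \<open>No set of the generated \<sigma>-algebra separates a point from its truncation; this is
  applied to the preimage of a single value.\<close>

lemma dyadic_constant_if_measurable:
  fixes g :: "walsh_group \<times> walsh_group \<Rightarrow> complex"
  assumes "g \<in> borel_measurable (dyadic_filtration N)"
  shows "dyadic_constant N g"
  unfolding dyadic_constant_def
proof (intro allI)
  fix x y
  let ?T = "(walsh_trunc N x, walsh_trunc N y)"
  have gen: "(x, y) \<in> A \<longleftrightarrow> ?T \<in> A" if "A \<in> sigma_sets UNIV {dyadic_interval N x \<times> dyadic_interval N y | x y. True}" for A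
    using that by induction (auto simp: dyadic_interval_def walsh_trunc_def)
  have "g -` {g ?T} \<inter> space (dyadic_filtration N) \<in> sets (dyadic_filtration N)"
    by (rule measurable_sets[OF assms]) simp
  then have "(x, y) \<in> g -` {g ?T} \<longleftrightarrow> ?T \<in> g -` {g ?T}"
    by (intro gen) (simp add: dyadic_filtration_def)
  then show "g (x, y) = g ?T" by simp
qed

lemma borel_measurable_dyadic_filtration:
  fixes g :: "walsh_group \<times> walsh_group \<Rightarrow> 'a :: topological_space"
  assumes "dyadic_constant N g"
  shows "g \<in> borel_measurable (dyadic_filtration N)"
proof (rule measurableI)
  fix A :: "'a set"
  let ?Q = "\<lambda>c. dyadic_interval N (fst c) \<times> dyadic_interval N (snd c)"
  have "?Q c \<in> sets (dyadic_filtration N)" for c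
    by (auto simp: dyadic_filtration_def)
  moreover have "finite (square_points N)" by simp
  ultimately have "(\<Union>c\<in>{c\<in>square_points N. g c \<in> A}. ?Q c) \<in> sets (dyadic_filtration N)"
    by (intro sets.finite_UN) auto
  also have "(\<Union>c\<in>{c\<in>square_points N. g c \<in> A}. ?Q c) = g -` A \<inter> space (dyadic_filtration N)"
  proof (intro set_eqI)
    fix z :: "walsh_group \<times> walsh_group"
    obtain x y where z: "z = (x, y)" by (cases z)
    have "z \<in> ?Q c \<longleftrightarrow> c = (walsh_trunc N x, walsh_trunc N y)" if "c \<in> square_points N" for c
      using that by (cases c) (auto simp: z dyadic_interval_iff_trunc)
    then show "z \<in> (\<Union>c\<in>{c\<in>square_points N. g c \<in> A}. ?Q c) \<longleftrightarrow> z \<in> g -` A \<inter> space (dyadic_filtration N)"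
      using assms by (auto simp: dyadic_filtration_def dyadic_constant_def z)
  qed
  finally show "g -` A \<inter> space (dyadic_filtration N) \<in> sets (dyadic_filtration N)" .
qed simp

section \<open>Walsh coefficients of a dyadic martingale as finite sums\<close>

lemma prob_space_walsh_haar2: "prob_space walsh_haar2"
proof -
  interpret prob_space walsh_haar by (rule prob_space_walsh_haar)
  interpret pair_prob_space walsh_haar walsh_haar by unfold_locales
  show ?thesis by unfold_locales
qed

text \<open>The martingale property tested against a bounded function measurable at level
  \<open>N\<close>, which can be pulled through the conditional expectation.\<close>

lemma dyadic_martingale_integral_eq:
  assumes f: "dyadic_martingale f" and k: "N \<le> k"
    and h: "dyadic_constant N h" "\<And>z. \<bar>h z :: real\<bar> \<le> 1"
  shows "(LINT z|walsh_haar2. f k z * of_real (h z)) = (LINT z|walsh_haar2. f N z * of_real (h z))"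
proof -
  interpret prob_space walsh_haar2 by (rule prob_space_walsh_haar2)
  interpret finite_measure_subalgebra walsh_haar2 "dyadic_filtration N"
    by unfold_locales (rule subalgebra_dyadic_filtration)
  have hF: "h \<in> borel_measurable (dyadic_filtration N)"
    by (rule borel_measurable_dyadic_filtration[OF h(1)])
  then have hM [measurable]: "h \<in> borel_measurable walsh_haar2"
    by (rule measurable_from_subalg[OF subalg])
  have int: "integrable walsh_haar2 (f n)" for n
    using f by (simp add: dyadic_martingale_def)
  have [measurable]: "f n \<in> borel_measurable walsh_haar2" for n
    using int by (rule borel_measurable_integrable)
  have inth: "integrable walsh_haar2 (\<lambda>z. f n z * of_real (h z))" for n
    by (rule Bochner_Integration.integrable_bound[OF int[of n]])
       (use h(2) in \<open>auto simp: norm_mult intro!: mult_left_le\<close>)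
  have AE: "AE z in walsh_haar2. complex_cond_exp walsh_haar2 (dyadic_filtration N) (f k) z = f N z"
    using f k by (simp add: dyadic_martingale_def)
  \<comment> \<open>\<open>T\<close> stands for \<open>Re\<close> and \<open>Im\<close>, since the
    conditional expectation is taken separately for the two parts.\<close>
  have part: "(LINT z|walsh_haar2. h z * T (f k z)) = (LINT z|walsh_haar2. h z * T (f N z))"
    if T: "bounded_linear T" 
      and T_mult: "\<And>u a. T (u * of_real a) = a * T u"
      and T_cond: "\<And>z. T (complex_cond_exp walsh_haar2 (dyadic_filtration N) (f k) z)
          = real_cond_exp walsh_haar2 (dyadic_filtration N) (\<lambda>z. T (f k z)) z" for T :: "complex \<Rightarrow> real"
  proof -
    have Tint: "integrable walsh_haar2 (\<lambda>z. T (f n z))" for n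
      by (rule integrable_bounded_linear[OF T int])
    then have Tm [measurable]: "(\<lambda>z. T (f n z)) \<in> borel_measurable walsh_haar2" for n
      by (rule borel_measurable_integrable)
    have "integrable walsh_haar2 (\<lambda>z. h z * T (f k z))"
      using integrable_bounded_linear[OF T inth[of k]] by (simp add: T_mult)
    then have "(LINT z|walsh_haar2. h z * T (f k z))
        = (LINT z|walsh_haar2. h z * real_cond_exp walsh_haar2 (dyadic_filtration N) (\<lambda>z. T (f k z)) z)"
      by (intro real_cond_exp_intg(2)[symmetric] hF Tm)
    also have "\<dots> = (LINT z|walsh_haar2. h z * T (f N z))"
    proof (rule integral_cong_AE)
      show "AE z in walsh_haar2. h z * real_cond_exp walsh_haar2 (dyadic_filtration N) (\<lambda>z. T (f k z)) z = h z * T (f N z)"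
        using AE by eventually_elim (simp add: T_cond[symmetric])
    qed (use borel_measurable_cond_exp2 in measurable)
    finally show ?thesis .
  qed
  have split: "T (LINT z|walsh_haar2. f n z * of_real (h z)) = (LINT z|walsh_haar2. h z * T (f n z))"
    if "bounded_linear T" "\<And>u a. T (u * of_real a) = a * T u" for T :: "complex \<Rightarrow> real" and n
    using integral_bounded_linear[OF that(1) inth[of n]] that(2) by simp
  show ?thesis
  proof (rule complex_eqI)
    show "Re (LINT z|walsh_haar2. f k z * of_real (h z)) = Re (LINT z|walsh_haar2. f N z * of_real (h z))"
      by (subst (1 2) split[of Re]) (auto intro!: part bounded_linear_Re simp: complex_cond_exp_def)
    show "Im (LINT z|walsh_haar2. f k z * of_real (h z)) = Im (LINT z|walsh_haar2. f N z * of_real (h z))"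
      by (subst (1 2) split[of Im]) (auto intro!: part bounded_linear_Im simp: complex_cond_exp_def)
  qed
qed

lemma walsh_walsh_trunc [simp]: "n < 2 ^ N \<Longrightarrow> walsh n (walsh_trunc N x) = walsh n x"
  by (rule walsh_cong) (auto simp: walsh_trunc_def)

text \<open>The product of the two Walsh functions is constant on squares of level \<open>N\<close>,
  so the integrals no longer change from k = N on and their limit is the value at
  \<open>N\<close>.\<close>

lemma walsh_coeff_eq:
  assumes f: "dyadic_martingale f" and ij: "i < 2 ^ N" "j < 2 ^ N"
  shows "walsh_coeff f i j
    = (\<Sum>c\<in>square_points N. f N c * of_real (walsh i (fst c) * walsh j (snd c))) / 4 ^ N"
proof -
  let ?h = "\<lambda>z. walsh i (fst z) * walsh j (snd z)"
  let ?I = "\<lambda>k. LINT z|walsh_haar2. f k z * of_real (?h z)"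
  have h: "dyadic_constant N ?h" using ij by (simp add: dyadic_constant_def)
  have "?I k = ?I N" if "N \<le> k" for k
    using that by (intro dyadic_martingale_integral_eq[OF f]) (auto simp: h abs_mult)
  then have "eventually (\<lambda>k. ?I k = ?I N) sequentially"
    by (rule eventually_sequentiallyI)
  then have "?I \<longlonglongrightarrow> ?I N"
    by (rule tendsto_eventually)
  then have "walsh_coeff f i j = ?I N"
    unfolding walsh_coeff_def by (intro limI) (simp add: mult.assoc)
  moreover have "dyadic_constant N (f N)"
    using f by (intro dyadic_constant_if_measurable) (simp add: dyadic_martingale_def)
  then have "dyadic_constant N (\<lambda>z. f N z * of_real (?h z))"
    using h unfolding dyadic_constant_def by metis
  ultimately show ?thesis
    by (simp add: integral_dyadic_constant)
qed

section \<open>Norm estimates for the Fejer means\<close>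

text \<open>Here 1 / 4^N is the measure of a square. Every element is its own negative, so
  \<open>wadd\<close> is also subtraction and this is a convolution kernel.\<close>

definition fejer_kernel :: "nat \<Rightarrow> nat \<Rightarrow> walsh_group \<times> walsh_group \<Rightarrow> walsh_group \<times> walsh_group \<Rightarrow> real" where
  "fejer_kernel N n z c = triangular_kernel n (wadd (fst z) (fst c)) (wadd (snd z) (snd c)) / (real n * 4 ^ N)"

text \<open>All frequencies involved are below n < 2^N, so the coefficients come from
  \<open>f N\<close> alone; \<open>walsh_wadd\<close> merges the characters at \<open>z\<close> and
  \<open>c\<close>.\<close>

lemma triangular_fejer_eq:
  assumes f: "dyadic_martingale f" and n: "n < 2 ^ N"
  shows "triangular_fejer n f z = (\<Sum>c\<in>square_points N. f N c * of_real (fejer_kernel N n z c))"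
proof -
  let ?g = "\<lambda>i l c. f N c * of_real (walsh i (wadd (fst z) (fst c)) * walsh l (wadd (snd z) (snd c)))"
  have swap: "(\<Sum>j<m. \<Sum>c\<in>square_points N. h j c) = (\<Sum>c\<in>square_points N. \<Sum>j<m. h j c)"
    for m :: nat and h :: "nat \<Rightarrow> walsh_group \<times> walsh_group \<Rightarrow> complex"
    by (rule sum.swap)
  have "triangular_fejer n f z = (\<Sum>j<n. \<Sum>i<j. \<Sum>l<j - i. (\<Sum>c\<in>square_points N. ?g i l c) / 4 ^ N) / of_nat n"
    unfolding triangular_fejer_def triangular_sum_def
  proof (intro arg_cong2[where f = "(/)"] sum.cong refl)
    fix j i l assume "j \<in> {..<n}" "i \<in> {..<j}" "l \<in> {..<j - i}"
    then have "i < 2 ^ N" "l < 2 ^ N" using n by auto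
    from walsh_coeff_eq[OF f this]
    show "walsh_coeff f i l * of_real (walsh i (fst z)) * of_real (walsh l (snd z))
        = (\<Sum>c\<in>square_points N. ?g i l c) / 4 ^ N"
      by (simp add: walsh_wadd sum_distrib_left sum_divide_distrib mult_ac)
  qed
  also have "\<dots> = (\<Sum>j<n. \<Sum>i<j. \<Sum>l<j - i. \<Sum>c\<in>square_points N. ?g i l c) / (of_nat n * 4 ^ N)"
    by (simp add: sum_divide_distrib mult.commute)
  also have "(\<Sum>j<n. \<Sum>i<j. \<Sum>l<j - i. \<Sum>c\<in>square_points N. ?g i l c)
      = (\<Sum>c\<in>square_points N. \<Sum>j<n. \<Sum>i<j. \<Sum>l<j - i. ?g i l c)"
    by (simp only: swap)
  also have "\<dots> = (\<Sum>c\<in>square_points N. f N c * of_real (triangular_kernel n (wadd (fst z) (fst c)) (wadd (snd z) (snd c))))"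
    unfolding triangular_kernel_eq by (simp only: of_real_sum sum_distrib_left)
  also have "\<dots> / (of_nat n * 4 ^ N) = (\<Sum>c\<in>square_points N. f N c * of_real (fejer_kernel N n z c))"
    by (simp add: fejer_kernel_def sum_divide_distrib)
  finally show ?thesis .
qed

lemma dyadic_constant_triangular_fejer:
  assumes "n < 2 ^ N"
  shows "dyadic_constant N (triangular_fejer n f)"
  unfolding dyadic_constant_def triangular_fejer_def triangular_sum_def
  using assms by (auto intro!: arg_cong2[where f = "(/)"] sum.cong)

lemma fejer_kernel_commute: "fejer_kernel N n z c = fejer_kernel N n c z"
  by (simp add: fejer_kernel_def wadd_commute)

lemma wadd_in_walsh_points:
  "x \<in> walsh_points J \<Longrightarrow> y \<in> walsh_points J \<Longrightarrow> wadd x y \<in> walsh_points J"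
  by (simp add: walsh_points_def wadd_def)

text \<open>Translation by \<open>z\<close> permutes the finite group, so each row sum equals the
  total sum of the kernel.\<close>

lemma fejer_kernel_powr_sum_le:
  assumes p: "4 / 5 < p" "p \<le> 1" and n: "n < 2 ^ N" "2 ^ N \<le> 2 * n" and z: "z \<in> square_points N"
  shows "(\<Sum>c\<in>square_points N. \<bar>fejer_kernel N n z c\<bar> powr p) \<le> kernel_bound p"
proof -
  have n0: "n > 0" using n(2) by (cases n) auto
  let ?w = "\<lambda>c. (wadd (fst z) (fst c), wadd (snd z) (snd c))"
  have "(\<Sum>c\<in>square_points N. \<bar>fejer_kernel N n z c\<bar> powr p)
      = (\<Sum>c\<in>square_points N. \<bar>triangular_kernel n (fst c) (snd c)\<bar> powr p / (real n * 4 ^ N) powr p)"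
    by (rule sum.reindex_bij_witness[of _ ?w ?w])
       (use z in \<open>auto simp: fejer_kernel_def powr_divide wadd_in_walsh_points\<close>)
  also have "\<dots> = (\<Sum>x\<in>walsh_points {..<N}. \<Sum>y\<in>walsh_points {..<N}. \<bar>triangular_kernel n x y\<bar> powr p) / (real n * 4 ^ N) powr p"
    by (simp add: sum.cartesian_product sum_divide_distrib case_prod_beta)
  also have "\<dots> \<le> kernel_bound p"
    using triangular_kernel_powr_sum_le[OF p n] n0 by (simp add: field_simps)
  finally show ?thesis .
qed

text \<open>For p \<le> 1 the kernel estimate bounds p-th powers, hence the root; for p > 1 the
  Schur test uses the l1 bound of the kernel.\<close>

definition fejer_constant :: "real \<Rightarrow> real" where
  "fejer_constant p = (if p \<le> 1 then kernel_bound p powr (1 / p) else kernel_bound 1)"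

lemma fejer_constant_nonneg: "fejer_constant p \<ge> 0"
  using kernel_bound_nonneg[of 1] by (simp add: fejer_constant_def)

text \<open>The kernel is symmetric in \<open>z\<close> and \<open>c\<close>, so the bound for its
  rows serves for its columns as well.\<close>

lemma triangular_fejer_powr_sum_le:
  assumes p: "4 / 5 < p" and n: "n < 2 ^ N" "2 ^ N \<le> 2 * n" and f: "dyadic_martingale f"
  shows "(\<Sum>z\<in>square_points N. cmod (triangular_fejer n f z) powr p)
    \<le> fejer_constant p powr p * (\<Sum>c\<in>square_points N. cmod (f N c) powr p)"
proof (cases "p \<le> 1")
  case True
  have "(\<Sum>z\<in>square_points N. cmod (triangular_fejer n f z) powr p)
    \<le> kernel_bound p * (\<Sum>c\<in>square_points N. cmod (f N c) powr p)"
    unfolding triangular_fejer_eq[OF f n(1)] using p True n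
    by (intro kernel_operator_bound_le_1)
       (auto simp: fejer_kernel_commute[of _ _ _ "(_, _)"] intro!: fejer_kernel_powr_sum_le)
  then show ?thesis
    using True p kernel_bound_nonneg[OF p] by (simp add: fejer_constant_def powr_powr)
next
  case False
  have "(\<Sum>c\<in>square_points N. \<bar>fejer_kernel N n z c\<bar>) \<le> kernel_bound 1" if "z \<in> square_points N" for z
    using fejer_kernel_powr_sum_le[OF _ _ n that, of 1] by simp
  then show ?thesis
    unfolding triangular_fejer_eq[OF f n(1)] using False kernel_bound_nonneg[of 1]
    by (simp only: fejer_constant_def if_False, intro kernel_operator_bound_ge_1)
       (auto simp: fejer_kernel_commute[of _ _ _ "(_, _)"])
qed

section \<open>Passage from finite sums to the Lp quasi-norms\<close>

lemma ennreal_power_ennreal: "0 \<le> a \<Longrightarrow> ennreal_power (ennreal a) r = ennreal (a powr r)"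
  by (simp add: ennreal_power_def)

lemma ennreal_power_mono:
  assumes "a \<le> b" "0 \<le> r" shows "ennreal_power a r \<le> ennreal_power b r"
proof (cases "b = \<top>")
  case False
  then show ?thesis
    using assms by (auto simp: ennreal_power_def top_unique less_top enn2real_mono intro!: ennreal_leI powr_mono2)
qed (simp add: ennreal_power_def)

lemma Lp_norm_mono:
  assumes "g \<in> borel_measurable walsh_haar2" "\<And>z. g z \<le> h z"
  shows "Lp_norm p g \<le> Lp_norm p h"
  using assms unfolding Lp_norm_def
  by (auto intro!: esssup_mono ennreal_power_mono nn_integral_mono)

lemma Lp_norm_dyadic_constant:
  fixes g :: "walsh_group \<times> walsh_group \<Rightarrow> complex"
  assumes "dyadic_constant N g" "0 < p"
  shows "Lp_norm (ennreal p) (\<lambda>z. ennreal (cmod (g z)))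
    = ennreal (((\<Sum>c\<in>square_points N. cmod (g c) powr p) / 4 ^ N) powr (1 / p))"
proof -
  have "dyadic_constant N (\<lambda>z. ennreal (cmod (g z) powr p))"
    using assms(1) unfolding dyadic_constant_def by metis
  then have "(\<integral>\<^sup>+z. ennreal (cmod (g z) powr p) \<partial>walsh_haar2)
      = (\<Sum>c\<in>square_points N. ennreal (cmod (g c) powr p)) * ennreal (1 / 4 ^ N)"
    by (rule nn_integral_dyadic_constant)
  also have "\<dots> = ennreal ((\<Sum>c\<in>square_points N. cmod (g c) powr p) / 4 ^ N)"
    by (simp add: sum_ennreal ennreal_mult[symmetric] sum_nonneg)
  finally show ?thesis
    using assms(2) by (simp add: Lp_norm_def ennreal_power_ennreal sum_nonneg)
qed

lemma Lp_norm_triangular_fejer_le: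
  assumes p: "4 / 5 < p" and n: "n < 2 ^ N" "2 ^ N \<le> 2 * n" and f: "dyadic_martingale f"
  shows "Lp_norm (ennreal p) (\<lambda>z. ennreal (cmod (triangular_fejer n f z)))
    \<le> ennreal (fejer_constant p) * Lp_norm (ennreal p) (\<lambda>z. ennreal (cmod (f N z)))"
proof -
  let ?F = "\<Sum>c\<in>square_points N. cmod (f N c) powr p"
  have fN: "dyadic_constant N (f N)"
    using f by (intro dyadic_constant_if_measurable) (simp add: dyadic_martingale_def)
  have "((\<Sum>z\<in>square_points N. cmod (triangular_fejer n f z) powr p) / 4 ^ N) powr (1 / p)
      \<le> (fejer_constant p powr p * ?F / 4 ^ N) powr (1 / p)"
    using p triangular_fejer_powr_sum_le[OF p n f]
    by (intro powr_mono2 divide_right_mono) (auto simp: sum_nonneg)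
  also have "\<dots> = (fejer_constant p powr p) powr (1 / p) * (?F / 4 ^ N) powr (1 / p)"
    by (simp only: powr_mult times_divide_eq_right[symmetric])
  also have "(fejer_constant p powr p) powr (1 / p) = fejer_constant p"
    using p fejer_constant_nonneg by (simp add: powr_powr)
  finally show ?thesis
    using p fejer_constant_nonneg
    by (simp add: Lp_norm_dyadic_constant[OF fN] Lp_norm_dyadic_constant[OF dyadic_constant_triangular_fejer[OF n(1)]]
        ennreal_mult[symmetric] ennreal_leI)
qed

lemma esssup_triangular_fejer_le:
  assumes n: "n < 2 ^ N" "2 ^ N \<le> 2 * n" and f: "dyadic_martingale f"
  shows "Lp_norm \<top> (\<lambda>z. ennreal (cmod (triangular_fejer n f z)))
    \<le> ennreal (kernel_bound 1) * Lp_norm \<top> (\<lambda>z. ennreal (cmod (f N z)))"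
proof -
  define E where "E = esssup walsh_haar2 (\<lambda>z. ennreal (cmod (f N z)))"
  have fN: "dyadic_constant N (f N)"
    using f by (intro dyadic_constant_if_measurable) (simp add: dyadic_martingale_def)
  \<comment> \<open>The essential supremum dominates every value, because a larger value would be
    taken on a whole square of positive measure.\<close>
  have E: "ennreal (cmod (f N c)) \<le> E" if c: "c \<in> square_points N" for c
  proof (rule ccontr)
    assume neg: "\<not> ennreal (cmod (f N c)) \<le> E"
    let ?Q = "dyadic_interval N (fst c) \<times> dyadic_interval N (snd c)"
    have "f N z = f N c" if "z \<in> ?Q" for z
    proof -
      have "c = (walsh_trunc N (fst z), walsh_trunc N (snd z))"
        using that c by (cases c; cases z) (auto simp: dyadic_interval_iff_trunc)
      then show ?thesis using fN unfolding dyadic_constant_def by (metis prod.collapse)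
    qed
    moreover have "AE z in walsh_haar2. ennreal (cmod (f N z)) \<le> E"
      unfolding E_def by (rule esssup_AE)
    ultimately have "AE z in walsh_haar2. z \<notin> ?Q"
      using neg by (elim AE_mp) (auto intro!: AE_I2)
    then have "emeasure walsh_haar2 ?Q = 0"
      by (subst (asm) AE_iff_measurable[OF sets_dyadic_square[of N "fst c" "snd c"]])
         (auto simp: space_pair_measure space_walsh_haar)
    then show False by (simp add: emeasure_dyadic_square)
  qed
  have le: "ennreal (cmod (triangular_fejer n f z)) \<le> ennreal (kernel_bound 1) * E"
    if z: "z \<in> square_points N" for z
  proof -
    have "ennreal (cmod (triangular_fejer n f z)) \<le> ennreal (\<Sum>c\<in>square_points N. \<bar>fejer_kernel N n z c\<bar> * cmod (f N c))"
      unfolding triangular_fejer_eq[OF f n(1)]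
      by (intro ennreal_leI order_trans[OF norm_sum]) (simp add: norm_mult mult.commute)
    also have "\<dots> = (\<Sum>c\<in>square_points N. ennreal \<bar>fejer_kernel N n z c\<bar> * ennreal (cmod (f N c)))"
      by (simp add: sum_ennreal[symmetric] ennreal_mult)
    also have "\<dots> \<le> (\<Sum>c\<in>square_points N. ennreal \<bar>fejer_kernel N n z c\<bar> * E)"
      by (intro sum_mono mult_left_mono E) auto
    also have "\<dots> = ennreal (\<Sum>c\<in>square_points N. \<bar>fejer_kernel N n z c\<bar>) * E"
      by (simp add: sum_distrib_right[symmetric] sum_ennreal)
    also have "\<dots> \<le> ennreal (kernel_bound 1) * E"
      using fejer_kernel_powr_sum_le[OF _ _ n z, of 1] by (intro mult_right_mono ennreal_leI) auto
    finally show ?thesis .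
  qed
  have \<sigma>: "dyadic_constant N (triangular_fejer n f)"
    by (rule dyadic_constant_triangular_fejer[OF n(1)])
  then have "dyadic_constant N (\<lambda>z. ennreal (cmod (triangular_fejer n f z)))"
    unfolding dyadic_constant_def by metis
  moreover have "ennreal (cmod (triangular_fejer n f z)) \<le> ennreal (kernel_bound 1) * E" for z
    using le[of "(walsh_trunc N (fst z), walsh_trunc N (snd z))"] \<sigma>
    unfolding dyadic_constant_def by (cases z) simp
  ultimately show ?thesis
    unfolding Lp_norm_def E_def[symmetric]
    by (simp add: E_def[symmetric]) (intro esssup_I measurable_dyadic_constant[of N] AE_I2, auto)
qed

theorem theorem1:
  fixes p :: ennreal
  assumes "ennreal (4 / 5) < p"
  shows "\<exists>c::real. \<forall>f \<in> hardy_space p.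
    (SUP n\<in>{1..}. Lp_norm p (\<lambda>z. ennreal (cmod (triangular_fejer n f z))))
      \<le> ennreal c * hardy_norm p f"
proof -
  \<comment> \<open>The constant is fixed before \<open>f\<close>, \<open>n\<close> and
    \<open>N\<close>, so it depends only on \<open>p\<close>.\<close>
  obtain C where C: "\<And>f n N. dyadic_martingale f \<Longrightarrow> n < 2 ^ N \<Longrightarrow> 2 ^ N \<le> 2 * n \<Longrightarrow>
    Lp_norm p (\<lambda>z. ennreal (cmod (triangular_fejer n f z)))
      \<le> ennreal C * Lp_norm p (\<lambda>z. ennreal (cmod (f N z)))"
  proof (cases p)
    case (real q)
    with assms have "4 / 5 < q" by (simp add: ennreal_less_iff)
    then show ?thesis
      using that[of "fejer_constant q"] Lp_norm_triangular_fejer_le real by blast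
  next
    case top
    then show ?thesis
      using that[of "kernel_bound 1"] esssup_triangular_fejer_le by blast
  qed
  show ?thesis
  proof (intro exI[of _ C] ballI SUP_least)
    fix f and n :: nat
    assume f: "f \<in> hardy_space p" and "n \<in> {1..}"
    \<comment> \<open>The level is N = k + 1: then n < 2^N gives the convolution formula and 2^N
      \<le> 2n the uniform kernel bound.\<close>
    then obtain k where "2 ^ k \<le> n" "n < 2 ^ Suc k"
      using ex_power_ivl1[of 2 n] by auto
    then have n: "n < 2 ^ Suc k" "2 ^ Suc k \<le> 2 * n" by auto
    have mart: "dyadic_martingale f" using f by (simp add: hardy_space_def)
    have "dyadic_constant (Suc k) (f (Suc k))"
      using mart by (intro dyadic_constant_if_measurable) (simp add: dyadic_martingale_def)
    then have "dyadic_constant (Suc k) (\<lambda>z. ennreal (cmod (f (Suc k) z)))"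
      unfolding dyadic_constant_def by metis
    then have "Lp_norm p (\<lambda>z. ennreal (cmod (f (Suc k) z))) \<le> hardy_norm p f"
      unfolding hardy_norm_def maximal_function_def
      by (intro Lp_norm_mono measurable_dyadic_constant[of "Suc k"] SUP_upper) auto
    then have "ennreal C * Lp_norm p (\<lambda>z. ennreal (cmod (f (Suc k) z))) \<le> ennreal C * hardy_norm p f"
      by (rule mult_left_mono) simp
    with C[OF mart n] show "Lp_norm p (\<lambda>z. ennreal (cmod (triangular_fejer n f z))) \<le> ennreal C * hardy_norm p f"
      by (rule order_trans)
  qed
qed

end
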